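(* Let $d\ge 2$, $n,M\in\mathbb{N}$ (positive integers), let $\Omega=\{x_j:j=1,\dots,M\}\subset\mathbb{S}^{d-1}$ with pairwise distinct $x_j$ be $q$-separated for some $q>0$, i.e. $\operatorname{sep}(\Omega)>q$, and let $n>2.5\pi d/q+1$. Moreover, let $\hat p_r\in\mathbb{R}^N$, $r=1,\dots,N$, be an orthonormal basis of $\mathbb{R}^N$ with $\hat p_r\in\ker(Y_n)^{\perp}$ for $r=1,\dots,M$, and let $p_r\colon\mathbb{S}^{d-1}\to\mathbb{R}$, $p_r=\sum_{k=0}^n\sum_{\ell=1}^{N_k}\hat p_{r,k}^{\ell}Y_k^\ell$. Then $p\colon\mathbb{S}^{d-1}\to\mathbb{R}$, $$p(x)=\frac{2\pi^{d/2}}{\Gamma(d/2)\,N}\sum_{r=1}^M|p_r(x)|^2,$$ is a polynomial on the sphere of degree at most $2n$ (i.e. the restriction to $\mathbb{S}^{d-1}$ of a real polynomial in $d$ variables of total degree at most $2n$), it fulfills $0\le p(x)\le1$ for all $x\in\mathbb{S}^{d-1}$, and $p(x)=1$ if and only if $x\in\Omega$.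
   Context: $\mathbb{S}^{d-1}=\{x\in\mathbb{R}^d:x^\top x=1\}$. For $k\in\mathbb{N}_0$, $H_k^d$ is the space of real spherical harmonics of degree $k$ on $\mathbb{S}^{d-1}$ (restrictions to the sphere of real homogeneous harmonic polynomials of degree $k$ in $d$ variables), $N_k=\dim H_k^d$, and $\{Y_k^\ell:\ell=1,\dots,N_k\}$ is a fixed basis of $H_k^d$ of real-valued functions, orthonormal in $L^2(\mathbb{S}^{d-1})$ with respect to the (unnormalized) surface measure, whose total mass is $2\pi^{d/2}/\Gamma(d/2)$. $N=\sum_{k=0}^nN_k$ is the dimension of the space of restrictions to $\mathbb{S}^{d-1}$ of real polynomials in $d$ variables of total degree at most $n$. The nonequispaced spherical Fourier matrix is $Y_n=(Y_k^\ell(x_j))\in\mathbb{R}^{M\times N}$, with rows indexed by $j=1,\dots,M$ and columns by $(k,\ell)$, $0\le k\le n$, $1\le\ell\le N_k$; coordinates of vectors in $\mathbb{R}^N$ are indexed correspondingly, so $\hat p_r=(\hat p_{r,k}^{\ell})_{k,\ell}$. Orthogonality in $\mathbb{R}^N$ is with respect to the standard inner product. The separation distance is $\operatorname{sep}(\Omega)=\min_{j\ne\ell}\arccos(x_j^\top x_\ell)$ (for $M=1$ there is no pair $j\neq\ell$ and the separation condition is regarded as satisfied). *)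

theory Defs
  imports "HOL-Analysis.Analysis" "HOL-Library.Function_Algebras"
begin

text \<open>Real-valued functions form a real vector space under the pointwise operations, so that
  \<^const>\<open>span\<close>, \<^const>\<open>dim\<close> and \<^const>\<open>independent\<close> apply to spaces of functions.\<close>

instantiation "fun" :: (type, real_vector) real_vector
begin

definition scaleR_fun :: "real \<Rightarrow> ('a \<Rightarrow> 'b) \<Rightarrow> 'a \<Rightarrow> 'b" where
  "scaleR_fun c f = (\<lambda>x. c *\<^sub>R f x)"

instance
  by standard (simp_all add: scaleR_fun_def fun_eq_iff scaleR_add_right scaleR_add_left)

end

lemma scaleR_fun_apply [simp]: "(c *\<^sub>R f) x = c *\<^sub>R f x"
  by (simp add: scaleR_fun_def)

definition orthonormal_basis_on ::
  "('v \<Rightarrow> 'v \<Rightarrow> real) \<Rightarrow> 'v::real_vector set \<Rightarrow> 'i set \<Rightarrow> ('i \<Rightarrow> 'v) \<Rightarrow> bool" where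
  "orthonormal_basis_on ip V J b \<longleftrightarrow>
     inj_on b J \<and> independent (b ` J) \<and> span (b ` J) = V \<and>
     (\<forall>i\<in>J. \<forall>j\<in>J. ip (b i) (b j) = (if i = j then 1 else 0))"


section \<open>Polynomials and spherical harmonics\<close>

text \<open>Polynomials in \<open>d = CARD('d)\<close> variables are represented by their polynomial functions.\<close>

definition monomial_fun :: "('d::finite \<Rightarrow> nat) \<Rightarrow> real ^ 'd \<Rightarrow> real" where
  "monomial_fun \<alpha> x = (\<Prod>i\<in>UNIV. (x $ i) ^ \<alpha> i)"

definition polys_deg_le :: "nat \<Rightarrow> (real ^ 'd::finite \<Rightarrow> real) set" where
  "polys_deg_le m = span {monomial_fun \<alpha> | \<alpha>. (\<Sum>i\<in>UNIV. \<alpha> i) \<le> m}"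

definition homogeneous_polys :: "nat \<Rightarrow> (real ^ 'd::finite \<Rightarrow> real) set" where
  "homogeneous_polys k = span {monomial_fun \<alpha> | \<alpha>. (\<Sum>i\<in>UNIV. \<alpha> i) = k}"

definition partial_deriv :: "'d::finite \<Rightarrow> (real ^ 'd \<Rightarrow> real) \<Rightarrow> real ^ 'd \<Rightarrow> real" where
  "partial_deriv i f x = deriv (\<lambda>t. f (x + t *\<^sub>R axis i 1)) 0"

definition laplacian :: "(real ^ 'd::finite \<Rightarrow> real) \<Rightarrow> real ^ 'd \<Rightarrow> real" where
  "laplacian f x = (\<Sum>i\<in>UNIV. partial_deriv i (partial_deriv i f) x)"

text \<open>Functions on the unit sphere are represented by functions on the whole space
  that vanish off the sphere.\<close>

definition on_sphere :: "(real ^ 'd::finite \<Rightarrow> real) \<Rightarrow> real ^ 'd \<Rightarrow> real" where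
  "on_sphere f = (\<lambda>x. if x \<in> sphere 0 1 then f x else 0)"

definition spherical_harmonics :: "nat \<Rightarrow> (real ^ 'd::finite \<Rightarrow> real) set" where
  "spherical_harmonics k =
     on_sphere ` {f \<in> homogeneous_polys k. \<forall>x. laplacian f x = 0}"

definition is_sphere_poly_deg_le :: "nat \<Rightarrow> (real ^ 'd::finite \<Rightarrow> real) \<Rightarrow> bool" where
  "is_sphere_poly_deg_le m f \<longleftrightarrow> (\<exists>g\<in>polys_deg_le m. \<forall>x\<in>sphere 0 1. f x = g x)"


section \<open>Surface measure on the unit sphere\<close>

text \<open>The surface measure of a Borel set \<open>A\<close> of the sphere is \<open>d\<close> times the
  Lebesgue measure of the open cone \<open>{t u | 0 < t < 1, u \<in> A}\<close>; note \<open>sgn x = x / norm x\<close>.\<close>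

definition sphere_measure :: "(real ^ 'd::finite) measure" where
  "sphere_measure =
     scale_measure (ennreal (real CARD('d)))
       (distr (restrict_space lborel (ball 0 1 - {0})) (restrict_space borel (sphere 0 1)) sgn)"

lemma emeasure_sphere_measure_total:
  "emeasure (sphere_measure :: (real ^ 'd::finite) measure) (sphere 0 1) =
     ennreal (2 * pi powr (real CARD('d) / 2) / Gamma (real CARD('d) / 2))"
proof -
  let ?B = "ball 0 1 - {0} :: (real ^ 'd) set"
  let ?d = "real CARD('d)"
  have maps: "sgn x \<in> sphere 0 1" if "x \<in> ?B" for x :: "real ^ 'd"
    using that by (simp add: norm_sgn)
  have meas: "sgn \<in> restrict_space lborel ?B \<rightarrow>\<^sub>M restrict_space borel (sphere 0 1)"
  proof (rule measurable_restrict_space2)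
    show "sgn \<in> space (restrict_space lborel ?B) \<rightarrow> sphere 0 1"
      using maps by (auto simp: space_restrict_space)
    have "(\<lambda>x :: real ^ 'd. x /\<^sub>R norm x) \<in> borel_measurable borel"
      by measurable
    then show "sgn \<in> restrict_space lborel ?B \<rightarrow>\<^sub>M borel"
      by (intro measurable_restrict_space1) (simp add: sgn_div_norm[abs_def])
  qed
  have sph: "sphere 0 1 \<in> sets (restrict_space borel (sphere 0 1 :: (real ^ 'd) set))"
    using sets.top[of "restrict_space borel (sphere 0 1 :: (real ^ 'd) set)"]
    by (simp add: space_restrict_space)
  have "sgn -` sphere 0 1 \<inter> space (restrict_space lborel ?B) = ?B"
    using maps by (auto simp: space_restrict_space)
  then have "emeasure (distr (restrict_space lborel ?B) (restrict_space borel (sphere 0 1)) sgn)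
      (sphere 0 1) = emeasure (restrict_space lborel ?B) ?B"
    by (subst emeasure_distr[OF meas sph]) simp
  also have "\<dots> = emeasure lborel ?B"
    by (subst emeasure_restrict_space) auto
  also have "\<dots> = emeasure lborel (ball 0 1 :: (real ^ 'd) set)"
    by (subst emeasure_Diff) auto
  also have "\<dots> = ennreal (unit_ball_vol ?d)"
    by (simp add: emeasure_ball)
  finally have total: "emeasure (sphere_measure :: (real ^ 'd) measure) (sphere 0 1) =
      ennreal (?d * unit_ball_vol ?d)"
    by (simp add: sphere_measure_def ennreal_mult')
  have "?d / 2 \<notin> \<int>\<^sub>\<le>\<^sub>0"
    using nonpos_Ints_nonpos[of "?d / 2"] zero_less_card_finite[where 'a = 'd] by linarith
  then have Gamma_eq: "Gamma (?d / 2 + 1) = ?d / 2 * Gamma (?d / 2)"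
    by (rule Gamma_plus1)
  have "?d * unit_ball_vol ?d = 2 * pi powr (?d / 2) / Gamma (?d / 2)"
    unfolding unit_ball_vol_def Gamma_eq by (simp add: field_simps)
  with total show ?thesis
    by simp
qed

definition sphere_L2_inner ::
  "(real ^ 'd::finite \<Rightarrow> real) \<Rightarrow> (real ^ 'd \<Rightarrow> real) \<Rightarrow> real" where
  "sphere_L2_inner f g = (\<integral>x. f x * g x \<partial>sphere_measure)"

definition orthonormal_harmonics_family ::
  "(nat \<Rightarrow> nat \<Rightarrow> real ^ 'd::finite \<Rightarrow> real) \<Rightarrow> bool" where
  "orthonormal_harmonics_family Y \<longleftrightarrow>
     (\<forall>k. orthonormal_basis_on sphere_L2_inner (spherical_harmonics k)
            {1..dim (spherical_harmonics k :: (real ^ 'd \<Rightarrow> real) set)} (Y k))"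


section \<open>Separation\<close>

definition sep :: "(real ^ 'd::finite) set \<Rightarrow> real" where
  "sep \<Omega> = Min {arccos (x \<bullet> y) | x y. x \<in> \<Omega> \<and> y \<in> \<Omega> \<and> x \<noteq> y}"

text \<open>A one-point set has no pair of distinct points and counts as separated.\<close>

definition q_separated :: "real \<Rightarrow> (real ^ 'd::finite) set \<Rightarrow> bool" where
  "q_separated q \<Omega> \<longleftrightarrow> (card \<Omega> \<ge> 2 \<longrightarrow> sep \<Omega> > q)"


section \<open>Coordinate spaces and matrices over finite index sets\<close>

text \<open>The space of real vectors indexed by \<open>I\<close>: vectors vanish off \<open>I\<close>.\<close>

definition coord_space :: "'i set \<Rightarrow> ('i \<Rightarrow> real) set" where
  "coord_space I = {v. \<forall>i. i \<notin> I \<longrightarrow> v i = 0}"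

definition coord_inner :: "'i set \<Rightarrow> ('i \<Rightarrow> real) \<Rightarrow> ('i \<Rightarrow> real) \<Rightarrow> real" where
  "coord_inner I v w = (\<Sum>i\<in>I. v i * w i)"

definition matrix_kernel :: "'j set \<Rightarrow> 'i set \<Rightarrow> ('j \<Rightarrow> 'i \<Rightarrow> real) \<Rightarrow> ('i \<Rightarrow> real) set" where
  "matrix_kernel J I A = {v \<in> coord_space I. \<forall>j\<in>J. (\<Sum>i\<in>I. A j i * v i) = 0}"

definition orth_complement :: "'i set \<Rightarrow> ('i \<Rightarrow> real) set \<Rightarrow> ('i \<Rightarrow> real) set" where
  "orth_complement I V = {v \<in> coord_space I. \<forall>w\<in>V. coord_inner I v w = 0}"

definition sph_fourier_matrix ::
  "(nat \<Rightarrow> nat \<Rightarrow> real ^ 'd::finite \<Rightarrow> real) \<Rightarrow> (nat \<Rightarrow> real ^ 'd) \<Rightarrow> nat \<Rightarrow> nat \<times> nat \<Rightarrow> real" where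
  "sph_fourier_matrix Y x j = (\<lambda>(k, l). Y k l (x j))"

end

theory Submission
  imports Defs
begin

text \<open>Let \<open>row y\<close> be the vector of all \<open>Y k l y\<close>. Rotation invariance makes its norm constant on
  the sphere, equal to the square root of \<open>N / \<sigma>\<close> with \<open>\<sigma>\<close> the surface area, and
  \<open>p y\<close> is \<open>\<sigma> / N\<close> times the squared norm of the projection of \<open>row y\<close> onto the span of
  \<open>p_hat 1, \<dots>, p_hat M\<close>. Evaluations at the points of \<open>\<Omega>\<close> are linearly independent already on
  polynomials of degree \<open>n - 1\<close>: a power of the Fejer kernel, together with a packing bound on
  dyadic shells, gives a diagonally dominant matrix. Therefore that span is the row space of the
  Fourier matrix, and \<open>p y = 1\<close> means that evaluation at \<open>y\<close> is a combination of evaluations at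
  \<open>\<Omega>\<close> in degree \<open>n\<close>. The spare degree allows multiplication by linear functions, which forces
  \<open>y \<in> \<Omega>\<close>.\<close>

section \<open>Polynomial functions and harmonic decomposition\<close>

text \<open>The condition on \<open>n\<close> enters as \<open>m * \<delta> \<ge> 5 * d\<close> with
  \<open>m = n - 1\<close> and \<open>\<delta> = 2 * q / pi\<close>. An angle above \<open>q\<close>
  forces a chord of at least \<open>2 * q / pi\<close>, whence \<open>2.5 * pi = 5 * pi / 2\<close>;
  the \<open>+ 1\<close> pays for the linear factors. One Fejer kernel decays only like the inverse
  square of the distance, while a shell at distance about \<open>2^k * \<delta>\<close> may hold on
  the order of \<open>2^(k*d)\<close> points. The \<open>d\<close>-th power of the kernel outweighs
  this growth, and sharing the degree \<open>m\<close> among \<open>d\<close> factors is what puts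
  \<open>d\<close> into the condition. The 5 makes the packing count \<open>(5 * 2^k)^d\<close>
  times the kernel bound \<open>(4 / (25 * 4^k))^d\<close> summable to less than 1. The hypotheses
  concern coefficients in the basis \<open>Y\<close>, whereas the kernel and the linear factors are
  polynomials. The harmonic decomposition bridges the two: it makes evaluation of any polynomial of
  degree at most \<open>n\<close> a linear functional of the row, so linear relations between rows
  become relations between point evaluations.\<close>

lemma sum_fun_apply: "(\<Sum>a\<in>A. f a) x = (\<Sum>a\<in>A. f a x)"
  for f :: "'a \<Rightarrow> 'b \<Rightarrow> 'c::comm_monoid_add"
  by (induction A rule: infinite_finite_induct) auto

lemma subspace_addI: "subspace S \<Longrightarrow> f \<in> S \<Longrightarrow> g \<in> S \<Longrightarrow> (\<lambda>x. f x + g x) \<in> S"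
  for f :: "'a \<Rightarrow> real"
  using subspace_add[of S f g] by (simp add: plus_fun_def)

lemma subspace_multI: "subspace S \<Longrightarrow> f \<in> S \<Longrightarrow> (\<lambda>x. c * f x) \<in> S"
  for f :: "'a \<Rightarrow> real"
  using subspace_scale[of S f c] by (simp add: scaleR_fun_def)

lemma subspace_zeroI: "subspace S \<Longrightarrow> (\<lambda>x. 0) \<in> S"
  for S :: "('a \<Rightarrow> real) set"
  using subspace_0[of S] by (simp add: zero_fun_def)

lemma subspace_sumI:
  fixes f :: "'b \<Rightarrow> 'a \<Rightarrow> real"
  assumes "subspace S" "\<And>a. a \<in> A \<Longrightarrow> f a \<in> S"
  shows "(\<lambda>x. \<Sum>a\<in>A. f a x) \<in> S"
proof -
  have "(\<lambda>x. \<Sum>a\<in>A. f a x) = (\<Sum>a\<in>A. f a)"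
    by (rule ext) (rule sum_fun_apply[symmetric])
  with subspace_sum[of S A f] assms show ?thesis
    by simp
qed

text \<open>Span induction asks for the subspace property of a predicate on functions; in this form
  it can be checked on explicit lambda terms.\<close>

lemma subspace_CollectI:
  fixes P :: "('a \<Rightarrow> real) \<Rightarrow> bool"
  assumes "P (\<lambda>x. 0)" "\<And>f g. P f \<Longrightarrow> P g \<Longrightarrow> P (\<lambda>x. f x + g x)" "\<And>c f. P f \<Longrightarrow> P (\<lambda>x. c * f x)"
  shows "subspace (Collect P)"
  using assms by (simp add: subspace_def plus_fun_def zero_fun_def scaleR_fun_def)

lemma subspace_homogeneous_polys [simp]: "subspace (homogeneous_polys k)"
  by (simp add: homogeneous_polys_def)

lemma subspace_polys_deg_le [simp]: "subspace (polys_deg_le k)"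
  by (simp add: polys_deg_le_def)

lemma monomial_fun_mult: "monomial_fun \<alpha> x * monomial_fun \<beta> x = monomial_fun (\<lambda>i. \<alpha> i + \<beta> i) x"
  by (simp add: monomial_fun_def power_add prod.distrib)

lemma monomial_fun_in_homogeneous: "(\<Sum>i\<in>UNIV. \<alpha> i) = k \<Longrightarrow> monomial_fun \<alpha> \<in> homogeneous_polys k"
  unfolding homogeneous_polys_def by (rule span_base) auto

lemma monomial_fun_in_polys_deg_le: "(\<Sum>i\<in>UNIV. \<alpha> i) \<le> k \<Longrightarrow> monomial_fun \<alpha> \<in> polys_deg_le k"
  unfolding polys_deg_le_def by (rule span_base) auto

lemma coord_eq_monomial_fun: "x $ i = monomial_fun (\<lambda>j. if j = i then 1 else 0) x"
  by (simp add: monomial_fun_def if_distrib[of "\<lambda>n. _ ^ n"] cong: if_cong)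

lemma homogeneous_polys_coord_mult:
  assumes "f \<in> homogeneous_polys k"
  shows "(\<lambda>x. x $ i * f x) \<in> homogeneous_polys (Suc k)"
  using assms unfolding homogeneous_polys_def[of k]
proof (induction rule: span_induct)
  case base
  show ?case
  proof (rule subspace_CollectI)
    fix f g :: "real ^ 'a \<Rightarrow> real" and c
    assume f: "(\<lambda>x. x $ i * f x) \<in> homogeneous_polys (Suc k)"
    show "(\<lambda>x. x $ i * (c * f x)) \<in> homogeneous_polys (Suc k)"
      using subspace_multI[OF _ f, of c] by (simp add: mult_ac)
    assume g: "(\<lambda>x. x $ i * g x) \<in> homogeneous_polys (Suc k)"
    show "(\<lambda>x. x $ i * (f x + g x)) \<in> homogeneous_polys (Suc k)"
      using subspace_addI[OF _ f g] by (simp add: distrib_left)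
  qed (simp add: subspace_zeroI)
next
  case (step f)
  then obtain \<alpha> where "f = monomial_fun \<alpha>" "(\<Sum>i\<in>UNIV. \<alpha> i) = k"
    by blast
  then show ?case
    by (simp add: coord_eq_monomial_fun[of _ i] monomial_fun_mult)
       (intro monomial_fun_in_homogeneous, simp add: sum.distrib)
qed

text \<open>A monomial of positive degree is a coordinate times a monomial of degree one less.
  Properties obtained from product rules therefore need only multiplication by a single coordinate;
  \<open>P\<close> takes the degree as an argument because that step raises it.\<close>

lemma homogeneous_polys_induct [consumes 1, case_names add scale one coord]:
  fixes f :: "real ^ 'd::finite \<Rightarrow> real"
  assumes f: "f \<in> homogeneous_polys k"
    and add: "\<And>k f g. f \<in> homogeneous_polys k \<Longrightarrow> g \<in> homogeneous_polys k \<Longrightarrow> P k f \<Longrightarrow> P k g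
      \<Longrightarrow> P k (\<lambda>x. f x + g x)"
    and scale: "\<And>k c f. f \<in> homogeneous_polys k \<Longrightarrow> P k f \<Longrightarrow> P k (\<lambda>x. c * f x)"
    and one: "P 0 (\<lambda>x. 1)"
    and coord: "\<And>k i f. f \<in> homogeneous_polys k \<Longrightarrow> P k f \<Longrightarrow> P (Suc k) (\<lambda>x. x $ i * f x)"
  shows "P k f"
proof -
  have mono: "P k (monomial_fun \<alpha>)" if "(\<Sum>i\<in>UNIV. \<alpha> i) = k" for k \<alpha>
    using that
  proof (induction k arbitrary: \<alpha>)
    case 0
    then have "monomial_fun \<alpha> = (\<lambda>x. 1)"
      by (simp add: monomial_fun_def[abs_def])
    with one show ?case
      by simp
  next
    case (Suc k)
    then obtain i where i: "\<alpha> i \<noteq> 0"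
      by (metis (mono_tags, lifting) nat.simps(3) sum.neutral)
    define \<beta> where "\<beta> j = (if j = i then \<alpha> i - 1 else \<alpha> j)" for j
    have eq: "\<alpha> = (\<lambda>j. (if j = i then 1 else 0) + \<beta> j)"
      using i by (auto simp: \<beta>_def)
    have "(\<Sum>i\<in>UNIV. \<alpha> i) = 1 + (\<Sum>i\<in>UNIV. \<beta> i)"
      by (subst eq, subst sum.distrib) simp
    with Suc.prems have \<beta>: "(\<Sum>i\<in>UNIV. \<beta> i) = k"
      by simp
    have "monomial_fun \<alpha> = (\<lambda>x. x $ i * monomial_fun \<beta> x)"
      by (subst eq) (simp add: coord_eq_monomial_fun[of _ i] monomial_fun_mult)
    with coord[OF monomial_fun_in_homogeneous[OF \<beta>] Suc.IH[OF \<beta>]] show ?case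
      by simp
  qed
  have "f \<in> homogeneous_polys k \<and> P k f"
    using f unfolding homogeneous_polys_def[of k]
  proof (induction rule: span_induct)
    case base
    show ?case
      unfolding homogeneous_polys_def[of k, symmetric]
    proof (rule subspace_CollectI)
      \<comment> \<open>Any monomial of degree \<open>k\<close> serves here: the zero function
        satisfies \<open>P k\<close> as zero times a function already known to satisfy it.\<close>
      define \<alpha> :: "'d \<Rightarrow> nat" where "\<alpha> = (\<lambda>i. if i = (SOME i. True) then k else 0)"
      have \<alpha>: "(\<Sum>i\<in>UNIV. \<alpha> i) = k"
        by (simp add: \<alpha>_def)
      show "(\<lambda>x. 0) \<in> homogeneous_polys k \<and> P k (\<lambda>x. 0)"
        using scale[OF monomial_fun_in_homogeneous[OF \<alpha>] mono[OF \<alpha>], of 0]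
        by (simp add: subspace_zeroI)
    qed (auto intro: add scale subspace_addI subspace_multI)
  next
    case (step f)
    then show ?case
      using mono by (auto intro: span_base)
  qed
  then show ?thesis ..
qed

lemma homogeneous_polys_subset: "k \<le> n \<Longrightarrow> homogeneous_polys k \<subseteq> polys_deg_le n"
  unfolding homogeneous_polys_def polys_deg_le_def by (rule span_mono) auto

lemma polys_deg_le_mono: "m \<le> n \<Longrightarrow> polys_deg_le m \<subseteq> polys_deg_le n"
  unfolding polys_deg_le_def by (rule span_mono) auto

lemma const_in_polys_deg_le: "(\<lambda>x. c) \<in> polys_deg_le n"
  using subspace_multI[OF subspace_polys_deg_le monomial_fun_in_polys_deg_le[of "\<lambda>_. 0" n], of c]
  by (simp add: monomial_fun_def)

lemma coord_in_polys_deg_le: "n \<ge> 1 \<Longrightarrow> (\<lambda>x. x $ i) \<in> polys_deg_le n"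
  unfolding coord_eq_monomial_fun[of _ i] by (rule monomial_fun_in_polys_deg_le) simp

lemma inner_in_polys_deg_le: "n \<ge> 1 \<Longrightarrow> (\<lambda>x. a \<bullet> x) \<in> polys_deg_le n"
  unfolding inner_vec_def
  by (auto intro!: subspace_sumI subspace_multI coord_in_polys_deg_le)

lemma polys_deg_le_mult:
  assumes f: "f \<in> polys_deg_le m" and g: "g \<in> polys_deg_le n"
  shows "(\<lambda>x. f x * g x) \<in> polys_deg_le (m + n)"
  using f unfolding polys_deg_le_def[of m]
proof (induction rule: span_induct)
  case base
  show ?case
  proof (rule subspace_CollectI)
    fix f h :: "real ^ 'a \<Rightarrow> real" and c
    assume f: "(\<lambda>x. f x * g x) \<in> polys_deg_le (m + n)"
    show "(\<lambda>x. c * f x * g x) \<in> polys_deg_le (m + n)"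
      using subspace_multI[OF _ f, of c] by (simp add: mult_ac)
    assume h: "(\<lambda>x. h x * g x) \<in> polys_deg_le (m + n)"
    show "(\<lambda>x. (f x + h x) * g x) \<in> polys_deg_le (m + n)"
      using subspace_addI[OF _ f h] by (simp add: distrib_right)
  qed (simp add: subspace_zeroI)
next
  case (step f)
  then obtain \<alpha> where \<alpha>: "f = monomial_fun \<alpha>" "(\<Sum>i\<in>UNIV. \<alpha> i) \<le> m"
    by blast
  show ?case
    using g unfolding polys_deg_le_def[of n]
  proof (induction rule: span_induct)
    case base
    show ?case
    proof (rule subspace_CollectI)
      fix h k :: "real ^ 'a \<Rightarrow> real" and c
      assume h: "(\<lambda>x. f x * h x) \<in> polys_deg_le (m + n)"
      show "(\<lambda>x. f x * (c * h x)) \<in> polys_deg_le (m + n)"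
        using subspace_multI[OF _ h, of c] by (simp add: mult_ac)
      assume k: "(\<lambda>x. f x * k x) \<in> polys_deg_le (m + n)"
      show "(\<lambda>x. f x * (h x + k x)) \<in> polys_deg_le (m + n)"
        using subspace_addI[OF _ h k] by (simp add: distrib_left)
    qed (simp add: subspace_zeroI)
  next
    case (step g)
    then obtain \<beta> where \<beta>: "g = monomial_fun \<beta>" "(\<Sum>i\<in>UNIV. \<beta> i) \<le> n"
      by blast
    show ?case
      unfolding \<alpha>(1) \<beta>(1) monomial_fun_mult
      using \<alpha>(2) \<beta>(2) by (intro monomial_fun_in_polys_deg_le) (simp add: sum.distrib)
  qed
qed

lemma polys_deg_le_power:
  assumes "f \<in> polys_deg_le m"
  shows "(\<lambda>x. f x ^ k) \<in> polys_deg_le (k * m)"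
proof (induction k)
  case 0
  show ?case
    by (simp add: const_in_polys_deg_le)
next
  case (Suc k)
  from polys_deg_le_mult[OF assms Suc] show ?case
    by simp
qed

lemma polys_deg_le_decompose:
  assumes "f \<in> polys_deg_le n"
  obtains g where "\<And>k. k \<le> n \<Longrightarrow> g k \<in> homogeneous_polys k" "f = (\<lambda>x. \<Sum>k\<le>n. g k x)"
proof -
  have "\<exists>g. (\<forall>k\<le>n. g k \<in> homogeneous_polys k) \<and> f = (\<lambda>x. \<Sum>k\<le>n. g k x)"
    using assms unfolding polys_deg_le_def
  proof (induction rule: span_induct)
    case base
    show ?case
    proof (rule subspace_CollectI)
      show "\<exists>g. (\<forall>k\<le>n. g k \<in> homogeneous_polys k) \<and> (\<lambda>x::real^'a. 0) = (\<lambda>x. \<Sum>k\<le>n. g k x :: real)"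
        by (rule exI[of _ "\<lambda>k x. 0"]) (simp add: subspace_zeroI)
    next
      fix f h :: "real ^ 'a \<Rightarrow> real"
      assume "\<exists>g. (\<forall>k\<le>n. g k \<in> homogeneous_polys k) \<and> f = (\<lambda>x. \<Sum>k\<le>n. g k x)"
      then obtain g where g: "\<forall>k\<le>n. g k \<in> homogeneous_polys k" "f = (\<lambda>x. \<Sum>k\<le>n. g k x)"
        by blast
      assume "\<exists>g. (\<forall>k\<le>n. g k \<in> homogeneous_polys k) \<and> h = (\<lambda>x. \<Sum>k\<le>n. g k x)"
      then obtain g' where g': "\<forall>k\<le>n. g' k \<in> homogeneous_polys k" "h = (\<lambda>x. \<Sum>k\<le>n. g' k x)"
        by blast
      show "\<exists>g. (\<forall>k\<le>n. g k \<in> homogeneous_polys k) \<and> (\<lambda>x. f x + h x) = (\<lambda>x. \<Sum>k\<le>n. g k x)"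
        using g g' by (intro exI[of _ "\<lambda>k x. g k x + g' k x"]) (simp add: subspace_addI sum.distrib)
    next
      fix f :: "real ^ 'a \<Rightarrow> real" and c
      assume "\<exists>g. (\<forall>k\<le>n. g k \<in> homogeneous_polys k) \<and> f = (\<lambda>x. \<Sum>k\<le>n. g k x)"
      then obtain g where g: "\<forall>k\<le>n. g k \<in> homogeneous_polys k" "f = (\<lambda>x. \<Sum>k\<le>n. g k x)"
        by blast
      show "\<exists>g. (\<forall>k\<le>n. g k \<in> homogeneous_polys k) \<and> (\<lambda>x. c * f x) = (\<lambda>x. \<Sum>k\<le>n. g k x)"
        using g by (intro exI[of _ "\<lambda>k x. c * g k x"]) (simp add: subspace_multI sum_distrib_left)
    qed
  next
    case (step f)
    then obtain \<alpha> where \<alpha>: "f = monomial_fun \<alpha>" "(\<Sum>i\<in>UNIV. \<alpha> i) \<le> n"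
      by blast
    let ?g = "\<lambda>k. if k = (\<Sum>i\<in>UNIV. \<alpha> i) then f else (\<lambda>x. 0)"
    have "?g k \<in> homogeneous_polys k" for k
      using \<alpha> by (cases "k = (\<Sum>i\<in>UNIV. \<alpha> i)") (simp_all add: subspace_zeroI monomial_fun_in_homogeneous)
    moreover have "f = (\<lambda>x. \<Sum>k\<le>n. ?g k x)"
      using \<alpha>(2) by (simp add: if_distribR fun_eq_iff)
    ultimately show ?case
      by (intro exI[of _ ?g] conjI allI impI)
  qed
  with that show ?thesis
    by blast
qed

section \<open>Partial derivatives and the Laplacian on homogeneous polynomials\<close>

lemma partial_deriv_eq:
  assumes "(f has_derivative f') (at x)"
  shows "partial_deriv i f x = f' (axis i 1)"
proof -
  have f: "(f has_derivative f') (at (x + 0 *\<^sub>R axis i 1))"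
    using assms by simp
  have "((\<lambda>t. f (x + t *\<^sub>R axis i 1)) has_derivative (\<lambda>t. f' (t *\<^sub>R axis i 1))) (at 0)"
    by (rule has_derivative_compose[where f = "\<lambda>t. x + t *\<^sub>R axis i 1" and g = f, OF _ f])
       (auto intro!: derivative_eq_intros)
  moreover have "(\<lambda>t. f' (t *\<^sub>R axis i 1)) = (\<lambda>t. f' (axis i 1) * t)"
    using has_derivative_linear[OF assms] by (simp add: linear_cmul mult.commute)
  ultimately show ?thesis
    unfolding partial_deriv_def by (intro DERIV_imp_deriv) (simp add: has_field_derivative_def)
qed

lemma has_derivative_coord [derivative_intros]:
  "((\<lambda>x. x $ i) has_derivative (\<lambda>h. h $ i)) F"
  by (rule bounded_linear_imp_has_derivative) (rule bounded_linear_vec_nth)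

text \<open>\<open>partial_deriv\<close> is defined by \<open>deriv\<close>, which obeys the usual
  rules only where a derivative exists. Membership in \<open>homogeneous_polys\<close> supplies it,
  so the rules below carry that hypothesis.\<close>

lemma homogeneous_polys_differentiable:
  assumes "f \<in> homogeneous_polys k"
  shows "f differentiable (at x)"
  using assms
proof (induction rule: homogeneous_polys_induct)
  case (coord k i f)
  have "(\<lambda>x. x $ i) differentiable (at x)"
    unfolding differentiable_def by (rule exI) (rule has_derivative_coord)
  with coord.IH show ?case
    by (rule differentiable_mult[rotated])
qed (auto intro: differentiable_add differentiable_mult)

lemma homogeneous_polys_has_derivative:
  assumes "f \<in> homogeneous_polys k"
  obtains f' where "(f has_derivative f') (at x)" "\<And>i. partial_deriv i f x = f' (axis i 1)"
  using homogeneous_polys_differentiable[OF assms] partial_deriv_eq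
  by (metis differentiable_def)

lemma partial_deriv_add:
  assumes "f \<in> homogeneous_polys k" "g \<in> homogeneous_polys k"
  shows "partial_deriv i (\<lambda>x. f x + g x) = (\<lambda>x. partial_deriv i f x + partial_deriv i g x)"
proof
  fix x
  obtain f' where f: "(f has_derivative f') (at x)" "\<And>i. partial_deriv i f x = f' (axis i 1)"
    using homogeneous_polys_has_derivative[OF assms(1)] by blast
  obtain g' where g: "(g has_derivative g') (at x)" "\<And>i. partial_deriv i g x = g' (axis i 1)"
    using homogeneous_polys_has_derivative[OF assms(2)] by blast
  show "partial_deriv i (\<lambda>x. f x + g x) x = partial_deriv i f x + partial_deriv i g x"
    using partial_deriv_eq[OF has_derivative_add[OF f(1) g(1)]] f(2) g(2) by simp
qed

lemma partial_deriv_scale: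
  assumes "f \<in> homogeneous_polys k"
  shows "partial_deriv i (\<lambda>x. c * f x) = (\<lambda>x. c * partial_deriv i f x)"
proof
  fix x
  obtain f' where f: "(f has_derivative f') (at x)" "\<And>i. partial_deriv i f x = f' (axis i 1)"
    using homogeneous_polys_has_derivative[OF assms(1)] by blast
  show "partial_deriv i (\<lambda>x. c * f x) x = c * partial_deriv i f x"
    using partial_deriv_eq[OF has_derivative_mult_right[OF f(1)]] f(2) by simp
qed

lemma partial_deriv_sum:
  assumes "finite A" "\<And>a. a \<in> A \<Longrightarrow> f a \<in> homogeneous_polys k"
  shows "partial_deriv i (\<lambda>x. \<Sum>a\<in>A. f a x) = (\<lambda>x. \<Sum>a\<in>A. partial_deriv i (f a) x)"
  using assms
proof (induction A rule: finite_induct)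
  case empty
  show ?case
    by (simp add: partial_deriv_def[abs_def])
next
  case (insert a A)
  then show ?case
    by (simp add: partial_deriv_add[of _ k] subspace_sumI)
qed

lemma partial_deriv_const [simp]: "partial_deriv i (\<lambda>x. c) = (\<lambda>x. 0)"
  by (simp add: partial_deriv_def[abs_def])

lemma partial_deriv_coord_mult:
  assumes "f \<in> homogeneous_polys k"
  shows "partial_deriv i (\<lambda>x. x $ j * f x) =
    (\<lambda>x. (if i = j then f x else 0) + x $ j * partial_deriv i f x)"
proof
  fix x
  obtain f' where f: "(f has_derivative f') (at x)" "\<And>i. partial_deriv i f x = f' (axis i 1)"
    using homogeneous_polys_has_derivative[OF assms(1)] by blast
  show "partial_deriv i (\<lambda>x. x $ j * f x) x =
      (if i = j then f x else 0) + x $ j * partial_deriv i f x"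
    using partial_deriv_eq[OF has_derivative_mult[OF has_derivative_coord f(1)], of i j] f(2)
    by (simp add: axis_def)
qed

lemma partial_deriv_homogeneous_0:
  assumes "f \<in> homogeneous_polys 0"
  shows "partial_deriv i f = (\<lambda>x. 0)"
proof -
  have "k = 0 \<longrightarrow> partial_deriv i f = (\<lambda>x. 0)" if "f \<in> homogeneous_polys k" for k
    using that
    by (induction rule: homogeneous_polys_induct) (auto simp: partial_deriv_add partial_deriv_scale)
  with assms show ?thesis
    by blast
qed

lemma partial_deriv_in_homogeneous:
  assumes "f \<in> homogeneous_polys k"
  shows "partial_deriv i f \<in> homogeneous_polys (k - 1)"
  using assms
proof (induction rule: homogeneous_polys_induct)
  case (coord k j f)
  have "(\<lambda>x. x $ j * partial_deriv i f x) \<in> homogeneous_polys k"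
  proof (cases k)
    \<comment> \<open>Truncated subtraction leaves the derivative in degree 0, and a coordinate
      factor would lift it to degree 1 instead of \<open>k = 0\<close>. The product lies in degree 0
      only because the derivative vanishes.\<close>
    case 0
    with coord show ?thesis
      by (simp add: partial_deriv_homogeneous_0 subspace_zeroI)
  next
    case (Suc m)
    then show ?thesis
      using homogeneous_polys_coord_mult[OF coord.IH] by simp
  qed
  moreover have "(\<lambda>x. if i = j then f x else 0) \<in> homogeneous_polys k"
    using coord by (cases "i = j") (auto simp: subspace_zeroI)
  ultimately show ?case
    by (simp add: partial_deriv_coord_mult[OF coord.hyps] subspace_addI)
qed (auto simp: partial_deriv_add partial_deriv_scale subspace_addI subspace_multI subspace_zeroI)

text \<open>Euler's identity evaluates the first-order cross terms that arise when the Laplacian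
  meets the factor \<open>x \<bullet> x\<close>.\<close>

lemma euler_homogeneous:
  assumes "f \<in> homogeneous_polys k"
  shows "(\<Sum>i\<in>UNIV. x $ i * partial_deriv i f x) = real k * f x"
  using assms
proof (induction rule: homogeneous_polys_induct)
  case (coord k j f)
  have "(\<Sum>i\<in>UNIV. x $ i * ((if i = j then f x else 0) + x $ j * partial_deriv i f x)) =
     x $ j * f x + x $ j * (\<Sum>i\<in>UNIV. x $ i * partial_deriv i f x)"
    by (simp add: distrib_left sum.distrib sum_distrib_left mult_ac if_distrib[of "\<lambda>a. _ * a"]
          cong: if_cong)
  then show ?case
    unfolding partial_deriv_coord_mult[OF coord.hyps] coord.IH by (simp add: algebra_simps)
next
  case (scale k c f)
  then show ?case
    by (simp add: partial_deriv_scale sum_distrib_left[symmetric] mult.left_commute)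
qed (simp_all add: partial_deriv_add distrib_left sum.distrib)

lemma laplacian_add:
  assumes f: "f \<in> homogeneous_polys k" and g: "g \<in> homogeneous_polys k"
  shows "laplacian (\<lambda>x. f x + g x) x = laplacian f x + laplacian g x"
  unfolding laplacian_def partial_deriv_add[OF f g]
    partial_deriv_add[OF partial_deriv_in_homogeneous[OF f] partial_deriv_in_homogeneous[OF g]]
  by (rule sum.distrib)

lemma laplacian_scale:
  assumes f: "f \<in> homogeneous_polys k"
  shows "laplacian (\<lambda>x. c * f x) x = c * laplacian f x"
  unfolding laplacian_def partial_deriv_scale[OF f]
    partial_deriv_scale[OF partial_deriv_in_homogeneous[OF f]]
  by (rule sum_distrib_left[symmetric])

lemma laplacian_sum:
  assumes A: "finite A" and f: "\<And>a. a \<in> A \<Longrightarrow> f a \<in> homogeneous_polys k"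
  shows "laplacian (\<lambda>x. \<Sum>a\<in>A. f a x) x = (\<Sum>a\<in>A. laplacian (f a) x)"
proof -
  have 1: "partial_deriv i (\<lambda>x. \<Sum>a\<in>A. f a x) = (\<lambda>x. \<Sum>a\<in>A. partial_deriv i (f a) x)" for i
    by (rule partial_deriv_sum[OF A f])
  have 2: "partial_deriv i (\<lambda>x. \<Sum>a\<in>A. partial_deriv i (f a) x) =
      (\<lambda>x. \<Sum>a\<in>A. partial_deriv i (partial_deriv i (f a)) x)" for i
    by (rule partial_deriv_sum[OF A partial_deriv_in_homogeneous[OF f]])
  show ?thesis
    unfolding laplacian_def 1 2 by (rule sum.swap)
qed

lemma laplacian_in_homogeneous:
  assumes "f \<in> homogeneous_polys k"
  shows "laplacian f \<in> homogeneous_polys (k - 2)"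
proof -
  have "partial_deriv i (partial_deriv i f) \<in> homogeneous_polys (k - 1 - 1)" for i
    using assms by (intro partial_deriv_in_homogeneous)
  then show ?thesis
    unfolding laplacian_def[abs_def] by (intro subspace_sumI) (simp_all add: numeral_2_eq_2)
qed

lemma laplacian_homogeneous_small:
  assumes "f \<in> homogeneous_polys k" "k < 2"
  shows "laplacian f x = 0"
proof -
  have "partial_deriv i f \<in> homogeneous_polys 0" for i
    using partial_deriv_in_homogeneous[OF assms(1), of i] assms(2) by simp
  then show ?thesis
    by (simp add: laplacian_def partial_deriv_homogeneous_0)
qed

lemma laplacian_coord_mult:
  assumes f: "f \<in> homogeneous_polys k"
  shows "laplacian (\<lambda>x. x $ j * f x) x = 2 * partial_deriv j f x + x $ j * laplacian f x"
\<comment> \<open>The degree count needs \<open>Suc (k - 1) = k\<close>, which fails for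
  \<open>k = 0\<close>; there both Laplacians and the derivative vanish.\<close>
proof (cases k)
  case 0
  then have "(\<lambda>x. x $ j * f x) \<in> homogeneous_polys 1"
    using homogeneous_polys_coord_mult[OF f] by simp
  with 0 f show ?thesis
    by (simp add: laplacian_homogeneous_small[of _ 1] laplacian_homogeneous_small[of _ 0]
        partial_deriv_homogeneous_0)
next
  case (Suc m)
  have *: "partial_deriv i (partial_deriv i (\<lambda>x. x $ j * f x)) x =
      (if i = j then 2 * partial_deriv i f x else 0) + x $ j * partial_deriv i (partial_deriv i f) x" for i
  proof -
    have d: "partial_deriv i f \<in> homogeneous_polys m"
      using partial_deriv_in_homogeneous[OF f] Suc by simp
    have 1: "(\<lambda>x. if i = j then f x else 0) \<in> homogeneous_polys k"
      using f by (cases "i = j") (auto simp: subspace_zeroI)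
    have 2: "(\<lambda>x. x $ j * partial_deriv i f x) \<in> homogeneous_polys k"
      using homogeneous_polys_coord_mult[OF d] Suc by simp
    show ?thesis
      unfolding partial_deriv_coord_mult[OF f] partial_deriv_add[OF 1 2] partial_deriv_coord_mult[OF d]
      by (cases "i = j") simp_all
  qed
  show ?thesis
    unfolding laplacian_def * by (simp add: sum.distrib sum_distrib_left)
qed

text \<open>Writing \<open>x \<bullet> x\<close> as a sum of squared coordinates and applying the
  product rule twice gives \<open>2 * f + 4 * (x $ j * partial_deriv j f x)\<close> for each
  \<open>j\<close>, besides the term with the Laplacian of \<open>f\<close>; Euler's identity sums
  these. The resulting constant is positive, so it can later be divided out.\<close>

lemma laplacian_norm_mult:
  fixes f :: "real ^ 'd::finite \<Rightarrow> real"
  assumes f: "f \<in> homogeneous_polys k"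
  shows "(\<lambda>x. (x \<bullet> x) * f x) \<in> homogeneous_polys (k + 2)"
    and "laplacian (\<lambda>x. (x \<bullet> x) * f x) x =
      (2 * real CARD('d) + 4 * real k) * f x + (x \<bullet> x) * laplacian f x"
proof -
  have eq: "(\<lambda>x. (x \<bullet> x) * f x) = (\<lambda>x. \<Sum>j\<in>UNIV. x $ j * (x $ j * f x))"
    by (simp add: inner_vec_def sum_distrib_right mult.assoc)
  have 1: "(\<lambda>x. x $ j * f x) \<in> homogeneous_polys (Suc k)" for j
    by (rule homogeneous_polys_coord_mult[OF f])
  have 2: "(\<lambda>x. x $ j * (x $ j * f x)) \<in> homogeneous_polys (k + 2)" for j
    using homogeneous_polys_coord_mult[OF 1] by simp
  show "(\<lambda>x. (x \<bullet> x) * f x) \<in> homogeneous_polys (k + 2)"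
    unfolding eq by (intro subspace_sumI 2) simp
  have "laplacian (\<lambda>x. (x \<bullet> x) * f x) x =
    (\<Sum>j\<in>UNIV. 2 * f x + 4 * (x $ j * partial_deriv j f x) + x $ j * x $ j * laplacian f x)"
    unfolding eq laplacian_sum[OF finite 2] laplacian_coord_mult[OF 1] laplacian_coord_mult[OF f]
        partial_deriv_coord_mult[OF f] by (simp add: algebra_simps)
  also have "\<dots> = (\<Sum>j\<in>(UNIV :: 'd set). 2 * f x) + 4 * (\<Sum>j\<in>UNIV. x $ j * partial_deriv j f x) +
      (\<Sum>j\<in>UNIV. x $ j * x $ j) * laplacian f x"
    by (simp only: sum.distrib sum_distrib_left sum_distrib_right)
  also have "\<dots> = (2 * real CARD('d) + 4 * real k) * f x + (x \<bullet> x) * laplacian f x"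
    unfolding euler_homogeneous[OF f] by (simp add: inner_vec_def algebra_simps)
  finally show "laplacian (\<lambda>x. (x \<bullet> x) * f x) x =
      (2 * real CARD('d) + 4 * real k) * f x + (x \<bullet> x) * laplacian f x" .
qed

section \<open>Powers of the squared norm and the harmonic decomposition\<close>

definition radial_mult :: "nat \<Rightarrow> (real ^ 'd::finite \<Rightarrow> real) \<Rightarrow> real ^ 'd \<Rightarrow> real" where
  "radial_mult j f = (\<lambda>x. (x \<bullet> x) ^ j * f x)"

lemma radial_mult_Suc: "radial_mult (Suc j) f = (\<lambda>x. (x \<bullet> x) * radial_mult j f x)"
  by (simp add: radial_mult_def mult.assoc)

lemma radial_mult_in_homogeneous:
  assumes "f \<in> homogeneous_polys k"
  shows "radial_mult j f \<in> homogeneous_polys (k + 2 * j)"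
proof (induction j)
  case 0
  show ?case
    using assms by (simp add: radial_mult_def)
next
  case (Suc j)
  show ?case
    unfolding radial_mult_Suc using laplacian_norm_mult(1)[OF Suc] by simp
qed

text \<open>Each further factor \<open>x \<bullet> x\<close> adds another positive constant. Only
  positivity of the total is recorded, since \<open>c\<close> serves solely as a divisor.\<close>

lemma laplacian_radial_mult:
  fixes f :: "real ^ 'd::finite \<Rightarrow> real"
  assumes f: "f \<in> homogeneous_polys k"
  shows "\<exists>c>0. \<forall>x. laplacian (radial_mult (Suc j) f) x =
      c * radial_mult j f x + radial_mult (Suc j) (laplacian f) x"
proof (induction j)
  case 0
  show ?case
  proof (intro exI conjI allI)
    show "2 * real CARD('d) + 4 * real k > 0"
      by (simp add: add_pos_nonneg)
    show "laplacian (radial_mult (Suc 0) f) x = (2 * real CARD('d) + 4 * real k) * radial_mult 0 f x +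
        radial_mult (Suc 0) (laplacian f) x" for x
      using laplacian_norm_mult(2)[OF f, of x] by (simp add: radial_mult_def)
  qed
next
  case (Suc j)
  then obtain c where c: "c > 0"
    "\<forall>x. laplacian (radial_mult (Suc j) f) x =
      c * radial_mult j f x + radial_mult (Suc j) (laplacian f) x"
    by (elim exE conjE)
  show ?case
  proof (intro exI conjI allI)
    show "2 * real CARD('d) + 4 * real (k + 2 * Suc j) + c > 0"
      using c(1) by (simp add: add_nonneg_pos)
    show "laplacian (radial_mult (Suc (Suc j)) f) x =
        (2 * real CARD('d) + 4 * real (k + 2 * Suc j) + c) * radial_mult (Suc j) f x +
        radial_mult (Suc (Suc j)) (laplacian f) x" for x
      unfolding radial_mult_Suc[of "Suc j"]
        laplacian_norm_mult(2)[OF radial_mult_in_homogeneous[OF f]] c(2)[rule_format]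
      by (simp add: radial_mult_def algebra_simps)
  qed
qed

text \<open>The remainder \<open>radial_mult (Suc j) (laplacian g)\<close> is removed by the induction hypothesis,
  since \<open>laplacian g\<close> has smaller degree.\<close>

lemma laplacian_radial_mult_surj:
  fixes g :: "real ^ 'd::finite \<Rightarrow> real"
  assumes "g \<in> homogeneous_polys k"
  shows "\<exists>w\<in>homogeneous_polys k. laplacian (radial_mult (Suc j) w) = radial_mult j g"
  using assms
\<comment> \<open>\<open>j\<close> has to vary: the hypothesis is applied to
  \<open>laplacian g\<close> with \<open>Suc j\<close> in place of \<open>j\<close>.\<close>
proof (induction k arbitrary: g j rule: less_induct)
  case (less k)
  obtain c where "c > 0 \<and> (\<forall>x. laplacian (radial_mult (Suc j) g) x =
      c * radial_mult j g x + radial_mult (Suc j) (laplacian g) x)"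
    using laplacian_radial_mult[OF less.prems, of j] ..
  note c = conjunct1[OF this] conjunct2[OF this, rule_format]
  have gj: "radial_mult (Suc j) g \<in> homogeneous_polys (k + 2 * Suc j)"
    by (rule radial_mult_in_homogeneous[OF less.prems])
  show ?case
  proof (cases "k < 2")
    case True
    then have 0: "laplacian g x = 0" for x
      by (rule laplacian_homogeneous_small[OF less.prems])
    have eq: "radial_mult (Suc j) (\<lambda>x. 1 / c * g x) = (\<lambda>x. 1 / c * radial_mult (Suc j) g x)"
      by (simp add: radial_mult_def mult_ac)
    have "laplacian (radial_mult (Suc j) (\<lambda>x. 1 / c * g x)) = radial_mult j g"
      unfolding eq laplacian_scale[OF gj] c(2) fun_eq_iff
      using c(1) 0 by (simp add: radial_mult_def)
    moreover have "(\<lambda>x. 1 / c * g x) \<in> homogeneous_polys k"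
      using less.prems by (rule subspace_multI[rotated]) simp
    ultimately show ?thesis
      by (rule bexI)
  next
    case False
    then have "laplacian g \<in> homogeneous_polys (k - 2)" "k - 2 < k"
      using laplacian_in_homogeneous[OF less.prems] by auto
    from less.IH[OF this(2,1), of "Suc j"] obtain w where w: "w \<in> homogeneous_polys (k - 2)"
      "laplacian (radial_mult (Suc (Suc j)) w) = radial_mult (Suc j) (laplacian g)" ..
    \<comment> \<open>Under the Laplacian the term with \<open>w\<close> cancels the remainder
      \<open>radial_mult (Suc j) (laplacian g)\<close>, and \<open>1/c\<close> normalises what is
      left.\<close>
    define v where "v = (\<lambda>x. (1/c) * (g x + (-1) * radial_mult 1 w x))"
    have deg: "k - 2 + 2 * 1 = k" "k - 2 + 2 * Suc (Suc j) = k + 2 * Suc j"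
      using False by simp_all
    have v: "v \<in> homogeneous_polys k"
      unfolding v_def
      using less.prems radial_mult_in_homogeneous[OF w(1), of 1, unfolded deg]
      by (intro subspace_multI subspace_addI subspace_homogeneous_polys)
    note wj = radial_mult_in_homogeneous[OF w(1), of "Suc (Suc j)", unfolded deg]
    note wj' = subspace_multI[OF subspace_homogeneous_polys wj, of "-1"]
    have eq: "radial_mult (Suc j) v =
        (\<lambda>x. (1/c) * (radial_mult (Suc j) g x + (-1) * radial_mult (Suc (Suc j)) w x))"
      by (simp add: v_def radial_mult_def fun_eq_iff field_simps)
    have "laplacian (radial_mult (Suc j) v) = radial_mult j g"
      unfolding eq laplacian_scale[OF subspace_addI[OF subspace_homogeneous_polys gj wj']]
        laplacian_add[OF gj wj'] laplacian_scale[OF wj] c(2) w(2) fun_eq_iff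
      using c(1) by simp
    with v show ?thesis
      by (intro bexI[of _ v])
  qed
qed

text \<open>Solving \<open>laplacian (radial_mult 1 w) = laplacian f\<close> with \<open>w\<close>
  of degree \<open>k - 2\<close> makes \<open>h = f - radial_mult 1 w\<close> harmonic. On the
  sphere the radial factor is 1, so \<open>f\<close> agrees there with \<open>h + w\<close>, and
  \<open>w\<close> is handled by induction.\<close>

lemma homogeneous_poly_on_sphere:
  fixes f :: "real ^ 'd::finite \<Rightarrow> real"
  assumes "f \<in> homogeneous_polys k"
  shows "on_sphere f \<in> span (\<Union>i\<le>k. spherical_harmonics i)"
  using assms
proof (induction k arbitrary: f rule: less_induct)
  case (less k)
  show ?case
  proof (cases "k < 2")
    case True
    then have "on_sphere f \<in> spherical_harmonics k"
      unfolding spherical_harmonics_def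
      using less.prems by (auto intro: laplacian_homogeneous_small)
    then show ?thesis
      by (intro span_base) auto
  next
    case False
    obtain w where w: "w \<in> homogeneous_polys (k - 2)"
      "laplacian (radial_mult (Suc 0) w) = radial_mult 0 (laplacian f)"
      using laplacian_radial_mult_surj[OF laplacian_in_homogeneous[OF less.prems], of 0] ..
    define h where "h = (\<lambda>x. f x + (-1) * radial_mult (Suc 0) w x)"
    have deg: "k - 2 + 2 * Suc 0 = k"
      using False by simp
    note xw = radial_mult_in_homogeneous[OF w(1), of "Suc 0", unfolded deg]
    note xw' = subspace_multI[OF subspace_homogeneous_polys xw, of "-1"]
    have "h \<in> homogeneous_polys k"
      unfolding h_def by (rule subspace_addI[OF subspace_homogeneous_polys less.prems xw'])
    moreover have "laplacian h x = 0" for x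
      unfolding h_def laplacian_add[OF less.prems xw'] laplacian_scale[OF xw] w(2)
      by (simp add: radial_mult_def)
    ultimately have 1: "on_sphere h \<in> span (\<Union>i\<le>k. spherical_harmonics i)"
      unfolding spherical_harmonics_def by (intro span_base) auto
    have "on_sphere w \<in> span (\<Union>i\<le>k-2. spherical_harmonics i)"
      using False by (intro less.IH w) auto
    also have "\<dots> \<subseteq> span (\<Union>i\<le>k. spherical_harmonics i)"
      by (intro span_mono UN_mono) auto
    finally have "on_sphere h + on_sphere w \<in> span (\<Union>i\<le>k. spherical_harmonics i)"
      by (intro span_add 1)
    also have "on_sphere h + on_sphere w = on_sphere f"
      by (auto simp: on_sphere_def h_def radial_mult_def fun_eq_iff dot_square_norm)
    finally show ?thesis .
  qed
qed

section \<open>The addition theorem on the diagonal\<close>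

text \<open>Rotation invariance of Lebesgue measure in the library (\<open>measure_orthogonal_image\<close>) is
  restricted to well-ordered index types. By Vitali's covering theorem an open set is, up to a null
  set, a disjoint union of balls, and these are mapped to balls of the same radius.\<close>

lemma emeasure_open_le_orthogonal_image:
  fixes T :: "'a::euclidean_space \<Rightarrow> 'a"
  assumes S: "open S" and T: "orthogonal_transformation T"
  shows "emeasure lborel S \<le> emeasure lborel (T ` S)"
proof -
  define K where "K = {(c, r). 0 < r \<and> ball c r \<subseteq> S}"
  \<comment> \<open>Vitali's theorem needs balls of \<open>K\<close> of arbitrarily small radius
    containing each point of \<open>S\<close>.\<close>
  have "\<exists>i. i \<in> K \<and> x \<in> ball (fst i) (snd i) \<and> snd i < e" if "x \<in> S" "0 < e" for x e
  proof -
    obtain r where r: "r > 0" "ball x r \<subseteq> S"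
      using S \<open>x \<in> S\<close> open_contains_ball by blast
    then have "(x, min r (e / 2)) \<in> K"
      using \<open>0 < e\<close> by (auto simp: K_def)
    with r \<open>0 < e\<close> show ?thesis
      by (intro exI[of _ "(x, min r (e / 2))"]) auto
  qed
  then obtain C where C: "countable C" "C \<subseteq> K"
      "pairwise (\<lambda>i j. disjnt (ball (fst i) (snd i)) (ball (fst j) (snd j))) C"
      "negligible (S - (\<Union>i\<in>C. ball (fst i) (snd i)))"
    by (rule Vitali_covering_theorem_balls)
  define B where "B i = ball (fst i) (snd i)" for i :: "'a \<times> real"
  have disj: "disjoint_family_on B C"
    using C(3) by (auto simp: disjoint_family_on_def pairwise_def disjnt_def B_def)
  have bij: "bij T"
    using T by (rule orthogonal_transformation_bij)
  have TB: "T ` B i = ball (T (fst i)) (snd i)" for i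
    unfolding B_def by (rule image_orthogonal_transformation_ball[OF T])
  have disjT: "disjoint_family_on (\<lambda>i. T ` B i) C"
    using disj bij by (simp add: disjoint_family_on_def bij_def flip: image_Int)
  have open_B: "open (\<Union>i\<in>C. B i)"
    by (auto simp: B_def)
  with S have "S - (\<Union>i\<in>C. B i) \<in> sets lborel"
    by (simp add: sets.Diff)
  \<comment> \<open>\<open>negligible\<close> refers to the completed measure; since the remainder
    is Borel, it is null for \<open>lborel\<close> too.\<close>
  then have "S - (\<Union>i\<in>C. B i) \<in> null_sets lborel"
    using C(4) unfolding B_def negligible_iff_null_sets by (simp add: null_sets_completion_iff)
  moreover have "B i \<subseteq> S" if "i \<in> C" for i
    using that C(2) by (cases i) (auto simp: K_def B_def)
  then have BS: "(\<Union>i\<in>C. B i) \<subseteq> S"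
    by (rule UN_least)
  then have "(\<Union>i\<in>C. B i) \<union> (S - (\<Union>i\<in>C. B i)) = S"
    by blast
  ultimately have "emeasure lborel S = emeasure lborel (\<Union>i\<in>C. B i)"
    using emeasure_Un_null_set[of "\<Union>i\<in>C. B i" lborel "S - (\<Union>i\<in>C. B i)"] open_B by simp
  also have "\<dots> = (\<integral>\<^sup>+i. emeasure lborel (B i) \<partial>count_space C)"
    using disj C(1) by (intro emeasure_UN_countable) (assumption | simp add: B_def)+
  also have "\<dots> = (\<integral>\<^sup>+i. emeasure lborel (T ` B i) \<partial>count_space C)"
  proof (intro nn_integral_cong)
    fix i assume "i \<in> space (count_space C)"
    then have "snd i \<ge> 0"
      using C(2) by (auto simp: K_def)
    then show "emeasure lborel (B i) = emeasure lborel (T ` B i)"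
      unfolding TB by (simp add: B_def emeasure_ball)
  qed
  also have "\<dots> = emeasure lborel (\<Union>i\<in>C. T ` B i)"
    using disjT C(1) by (intro emeasure_UN_countable[symmetric]) (assumption | simp add: TB)+
  \<comment> \<open>The image of the null remainder is dropped here, so only an inequality results.
    The converse comes later from the same bound for the inverse of \<open>T\<close>.\<close>
  also have "\<dots> \<le> emeasure lborel (T ` S)"
  proof (rule emeasure_mono)
    have "continuous_on UNIV (inv T)"
      using orthogonal_transformation_inv[OF T] by (intro linear_continuous_on linear_conv_bounded_linear[THEN iffD1] orthogonal_transformation_linear)
    then have "open (inv T -` S)"
      using S by (simp add: continuous_on_open_vimage[OF open_UNIV])
    then show "T ` S \<in> sets lborel"
      using bij by (simp add: bij_vimage_eq_inv_image[OF bij_imp_bij_inv] inv_inv_eq)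
  qed (use BS in auto)
  finally show ?thesis .
qed

lemma orthogonal_transformation_measurable:
  fixes T :: "'a::euclidean_space \<Rightarrow> 'a"
  assumes "orthogonal_transformation T"
  shows "T \<in> borel_measurable borel"
  using assms
  by (intro borel_measurable_continuous_onI linear_continuous_on
      linear_conv_bounded_linear[THEN iffD1] orthogonal_transformation_linear)

text \<open>The preceding inequality for \<open>T\<close> and for its inverse gives equality on open
  sets. These form an intersection-stable generator, and the balls of integer radius exhaust the
  space with finite measure, so the measures coincide.\<close>

lemma distr_lborel_orthogonal_transformation:
  fixes T :: "'a::euclidean_space \<Rightarrow> 'a"
  assumes T: "orthogonal_transformation T"
  shows "distr lborel borel T = lborel"
proof (rule measure_eqI_generator_eq)
  have bij: "bij T"
    using T by (rule orthogonal_transformation_bij)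
  note iT = orthogonal_transformation_inv[OF T]
  have open_eq: "emeasure (distr lborel borel T) X = emeasure lborel X" if "open X" for X
  proof -
    have "open (T -` X)"
      using that T by (intro open_vimage linear_continuous_on
          linear_conv_bounded_linear[THEN iffD1] orthogonal_transformation_linear)
    then have "emeasure lborel (T -` X) \<le> emeasure lborel X"
      using emeasure_open_le_orthogonal_image[OF _ T, of "T -` X"] bij
      by (simp add: bij_is_surj surj_image_vimage_eq)
    moreover have "emeasure lborel X \<le> emeasure lborel (T -` X)"
      using emeasure_open_le_orthogonal_image[OF that iT] bij by (simp add: bij_vimage_eq_inv_image)
    ultimately show ?thesis
      using that orthogonal_transformation_measurable[OF T] by (simp add: emeasure_distr)
  qed
  show "Int_stable {S :: 'a set. open S}"
    by (auto simp: Int_stable_def)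
  show "emeasure (distr lborel borel T) X = emeasure lborel X" if "X \<in> {S. open S}" for X
    using that by (simp add: open_eq)
  show "emeasure (distr lborel borel T) (ball 0 (real i)) \<noteq> \<infinity>" for i
    by (simp add: open_eq emeasure_ball)
  show "(\<Union>i. ball (0 :: 'a) (real i)) = UNIV"
    by (auto simp: real_arch_simple reals_Archimedean2)
qed (auto simp: borel_def)

section \<open>Rotation invariance of the surface measure\<close>

lemma space_sphere_measure [simp]: "space sphere_measure = sphere 0 1"
  by (simp add: sphere_measure_def space_scale_measure space_restrict_space)

lemma sets_sphere_measure [simp, measurable_cong]:
  "sets sphere_measure = sets (restrict_space borel (sphere 0 1))"
  by (simp add: sphere_measure_def)

text \<open>Passing to the cone over \<open>A\<close> transfers questions about the surface measure
  to Lebesgue measure.\<close>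

lemma emeasure_sphere_measure:
  fixes A :: "(real ^ 'd::finite) set"
  assumes A: "A \<in> sets borel" "A \<subseteq> sphere 0 1"
  shows "{x \<in> ball 0 1 - {0}. sgn x \<in> A} \<in> sets borel"
    and "emeasure sphere_measure A =
      ennreal (real CARD('d)) * emeasure lborel {x \<in> ball 0 1 - {0}. sgn x \<in> A}"
proof -
  let ?B = "ball 0 1 - {0} :: (real ^ 'd) set"
  have sgn: "sgn \<in> borel_measurable (borel :: (real ^ 'd) measure)"
  proof -
    have "(\<lambda>x :: real ^ 'd. x /\<^sub>R norm x) \<in> borel_measurable borel"
      by measurable
    then show ?thesis
      by (simp add: sgn_div_norm[abs_def])
  qed
  have eq: "{x \<in> ?B. sgn x \<in> A} = sgn -` A \<inter> ?B"
    by auto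
  show *: "{x \<in> ?B. sgn x \<in> A} \<in> sets borel"
    unfolding eq using measurable_sets_borel[OF sgn A(1)] by auto
  have meas: "sgn \<in> restrict_space lborel ?B \<rightarrow>\<^sub>M restrict_space borel (sphere 0 1)"
  proof (rule measurable_restrict_space2)
    show "sgn \<in> space (restrict_space lborel ?B) \<rightarrow> sphere 0 1"
      by (auto simp: space_restrict_space norm_sgn)
    show "sgn \<in> restrict_space lborel ?B \<rightarrow>\<^sub>M borel"
      using sgn by (intro measurable_restrict_space1) simp
  qed
  have AS: "A \<in> sets (restrict_space borel (sphere 0 1))"
    using A by (simp add: sets_restrict_space_iff)
  have "emeasure sphere_measure A = ennreal (real CARD('d)) *
      emeasure (restrict_space lborel ?B) (sgn -` A \<inter> ?B)"
    by (simp add: sphere_measure_def emeasure_distr[OF meas AS] space_restrict_space)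
  also have "emeasure (restrict_space lborel ?B) (sgn -` A \<inter> ?B) =
      emeasure lborel {x \<in> ball 0 1 - {0}. sgn x \<in> A}"
    unfolding eq by (rule emeasure_restrict_space) auto
  finally show "emeasure sphere_measure A =
      ennreal (real CARD('d)) * emeasure lborel {x \<in> ball 0 1 - {0}. sgn x \<in> A}" .
qed

text \<open>Orthogonal maps commute with the radial projection \<open>sgn\<close>, so the cone over
  a preimage is the preimage of the cone, and invariance of Lebesgue measure applies.\<close>

lemma distr_sphere_measure_orthogonal_transformation:
  fixes T :: "real ^ 'd::finite \<Rightarrow> real ^ 'd"
  assumes T: "orthogonal_transformation T"
  shows "T \<in> sphere_measure \<rightarrow>\<^sub>M sphere_measure"
    and "distr sphere_measure sphere_measure T = sphere_measure"
proof -
  note Tm = orthogonal_transformation_measurable[OF T]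
  show *: "T \<in> sphere_measure \<rightarrow>\<^sub>M sphere_measure"
    using Tm orthogonal_transformation_norm[OF T]
    by (simp add: measurable_cong_sets[OF sets_sphere_measure sets_sphere_measure])
       (intro measurable_restrict_space3, auto)
  show "distr sphere_measure sphere_measure T = sphere_measure"
  proof (rule measure_eqI)
    fix A :: "(real ^ 'd) set"
    assume "A \<in> sets (distr sphere_measure sphere_measure T)"
    then have A: "A \<in> sets borel" "A \<subseteq> sphere 0 1" and A': "A \<in> sets sphere_measure"
      by (auto simp: sets_restrict_space_iff)
    let ?X = "{x \<in> ball 0 1 - {0}. sgn x \<in> A}"
    have TA: "T -` A \<subseteq> sphere 0 1" "T -` A \<in> sets borel"
      using A orthogonal_transformation_norm[OF T] measurable_sets_borel[OF Tm] by auto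
    have sgn: "sgn (T x) = T (sgn x)" for x
      by (simp add: sgn_div_norm orthogonal_transformation_norm[OF T]
          linear_cmul[OF orthogonal_transformation_linear[OF T]])
    have "{x \<in> ball 0 1 - {0}. sgn x \<in> T -` A} = T -` ?X"
      using orthogonal_transformation_norm[OF T] by (auto simp: sgn) (metis norm_eq_zero)+
    then have "emeasure lborel {x \<in> ball 0 1 - {0}. sgn x \<in> T -` A} =
        emeasure (distr lborel borel T) ?X"
      using emeasure_sphere_measure(1)[OF A] Tm by (simp add: emeasure_distr)
    also have "\<dots> = emeasure lborel ?X"
      by (simp add: distr_lborel_orthogonal_transformation[OF T])
    finally show "emeasure (distr sphere_measure sphere_measure T) A = emeasure sphere_measure A"
      using TA by (simp add: emeasure_distr[OF * A'] Int_absorb2 emeasure_sphere_measure(2)[OF A]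
          emeasure_sphere_measure(2)[OF TA(2,1)])
  qed simp
qed

lemma finite_measure_sphere_measure: "finite_measure (sphere_measure :: (real ^ 'd::finite) measure)"
  by (rule finite_measureI) (simp add: emeasure_sphere_measure_total)

lemma measure_sphere_measure_total:
  "measure (sphere_measure :: (real ^ 'd::finite) measure) (sphere 0 1) =
     2 * pi powr (real CARD('d) / 2) / Gamma (real CARD('d) / 2)"
  by (simp add: measure_def emeasure_sphere_measure_total Gamma_real_pos less_imp_le)

lemma measurable_sphere_measure:
  "continuous_on (sphere 0 1) f \<Longrightarrow> f \<in> borel_measurable sphere_measure"
  by (simp add: measurable_cong_sets[OF sets_sphere_measure refl]
      borel_measurable_continuous_on_restrict)

lemma integrable_sphere_measure:
  fixes f :: "real ^ 'd::finite \<Rightarrow> real"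
  assumes f: "continuous_on (sphere 0 1) f"
  shows "integrable sphere_measure f"
proof -
  have "compact (f ` sphere 0 1)"
    using f by (rule compact_continuous_image) simp
  then obtain B where "\<forall>y\<in>f ` sphere 0 1. norm y \<le> B"
    using compact_imp_bounded bounded_iff by blast
  then show ?thesis
    using measurable_sphere_measure[OF f]
    by (intro finite_measure.integrable_const_bound[OF finite_measure_sphere_measure, of _ B]) auto
qed

lemma sphere_L2_inner_orthogonal_transformation:
  fixes T :: "real ^ 'd::finite \<Rightarrow> real ^ 'd"
  assumes T: "orthogonal_transformation T"
    and f: "continuous_on (sphere 0 1) f" and g: "continuous_on (sphere 0 1) g"
  shows "sphere_L2_inner (\<lambda>x. f (T x)) (\<lambda>x. g (T x)) = sphere_L2_inner f g"
proof -
  have "sphere_L2_inner f g = (\<integral>x. f x * g x \<partial>distr sphere_measure sphere_measure T)"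
    by (simp add: sphere_L2_inner_def distr_sphere_measure_orthogonal_transformation(2)[OF T])
  also have "\<dots> = sphere_L2_inner (\<lambda>x. f (T x)) (\<lambda>x. g (T x))"
    unfolding sphere_L2_inner_def
    by (rule integral_distr[OF distr_sphere_measure_orthogonal_transformation(1)[OF T]])
       (intro measurable_sphere_measure continuous_intros f g)
  finally show ?thesis ..
qed

section \<open>Rotation invariance of spherical harmonics\<close>

lemma sum_scaleR_axis: "(\<Sum>j\<in>UNIV. (x $ j) *\<^sub>R axis j 1) = x"
  for x :: "real ^ 'd::finite"
  using basis_expansion[of x] by (simp add: scalar_mult_eq_scaleR)

lemma homogeneous_polys_linear:
  assumes f: "f \<in> homogeneous_polys k" and T: "linear T"
  shows "(\<lambda>x. f (T x)) \<in> homogeneous_polys k"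
  using f
proof (induction rule: homogeneous_polys_induct)
  case one
  show ?case
    using monomial_fun_in_homogeneous[of "\<lambda>_. 0" 0] by (simp add: monomial_fun_def[abs_def])
next
  case (coord k i f)
  have Tx: "T x $ i = (\<Sum>j\<in>UNIV. T (axis j 1) $ i * x $ j)" for x
  proof -
    have "T (\<Sum>j\<in>UNIV. (x $ j) *\<^sub>R axis j 1) = (\<Sum>j\<in>UNIV. (x $ j) *\<^sub>R T (axis j 1))"
      by (simp add: linear_sum[OF T] linear_cmul[OF T])
    then show ?thesis
      unfolding sum_scaleR_axis by (simp add: mult.commute)
  qed
  have "(\<lambda>x. T x $ i * f (T x)) = (\<lambda>x. \<Sum>j\<in>UNIV. T (axis j 1) $ i * (x $ j * f (T x)))"
    by (rule ext, subst Tx) (simp add: sum_distrib_right mult.assoc)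
  then show ?case
    by (simp only:) (intro subspace_sumI subspace_multI subspace_homogeneous_polys
        homogeneous_polys_coord_mult coord.IH)
qed (simp_all only: subspace_addI subspace_multI subspace_homogeneous_polys)

lemma partial_deriv_linear:
  assumes f: "f \<in> homogeneous_polys k" and T: "linear T"
  shows "partial_deriv i (\<lambda>x. f (T x)) =
    (\<lambda>x. \<Sum>j\<in>UNIV. T (axis i 1) $ j * partial_deriv j f (T x))"
proof
  fix x
  obtain f' where f': "(f has_derivative f') (at (T x))" "\<And>i. partial_deriv i f (T x) = f' (axis i 1)"
    using homogeneous_polys_has_derivative[OF f] by blast
  have "((\<lambda>x. f (T x)) has_derivative (\<lambda>h. f' (T h))) (at x)"
    by (rule has_derivative_compose[where f = T, OF linear_imp_has_derivative[OF T] f'(1)])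
  then have "partial_deriv i (\<lambda>x. f (T x)) x = f' (T (axis i 1))"
    by (rule partial_deriv_eq)
  also have "T (axis i 1) = (\<Sum>j\<in>UNIV. (T (axis i 1) $ j) *\<^sub>R axis j 1)"
    by (rule sum_scaleR_axis[symmetric])
  also have "f' \<dots> = (\<Sum>j\<in>UNIV. T (axis i 1) $ j * partial_deriv j f (T x))"
    using has_derivative_linear[OF f'(1)] by (simp add: linear_sum linear_cmul f'(2))
  finally show "partial_deriv i (\<lambda>x. f (T x)) x =
      (\<Sum>j\<in>UNIV. T (axis i 1) $ j * partial_deriv j f (T x))" .
qed

text \<open>The chain rule contracts the second derivatives with the sums over \<open>i\<close> of
  \<open>?t i j * ?t i l\<close>. These are the inner products of the rows of the matrix of
  \<open>T\<close>, hence form the identity matrix.\<close>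

lemma laplacian_orthogonal_transformation:
  fixes T :: "real ^ 'd::finite \<Rightarrow> real ^ 'd"
  assumes f: "f \<in> homogeneous_polys k" and T: "orthogonal_transformation T"
  shows "laplacian (\<lambda>x. f (T x)) x = laplacian f (T x)"
proof -
  let ?t = "\<lambda>i j. T (axis i 1) $ j"
  note lin = orthogonal_transformation_linear[OF T]
  note d = partial_deriv_in_homogeneous[OF f]
  have dT: "(\<lambda>x. ?t i j * partial_deriv j f (T x)) \<in> homogeneous_polys (k - 1)" for i j
    by (rule subspace_multI[OF _ homogeneous_polys_linear[OF d lin]]) simp
  have orth: "(\<Sum>i\<in>UNIV. ?t i j * ?t i l) = (if j = l then 1 else 0)" for j l
  proof -
    have "matrix T ** transpose (matrix T) = mat 1"
      using T by (simp add: orthogonal_transformation_matrix orthogonal_matrix_def)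
    then have "(matrix T ** transpose (matrix T)) $ j $ l = (mat 1 :: real ^ 'd ^ 'd) $ j $ l"
      by simp
    then show ?thesis
      by (simp add: matrix_matrix_mult_def transpose_def matrix_def mat_def)
  qed
  have "partial_deriv i (partial_deriv i (\<lambda>x. f (T x))) x =
      (\<Sum>j\<in>UNIV. \<Sum>l\<in>UNIV. ?t i j * ?t i l * partial_deriv l (partial_deriv j f) (T x))" for i
    unfolding partial_deriv_linear[OF f lin] partial_deriv_sum[OF finite dT]
      partial_deriv_scale[OF homogeneous_polys_linear[OF d lin]] partial_deriv_linear[OF d lin]
    by (simp add: sum_distrib_left mult.assoc)
  then have "laplacian (\<lambda>x. f (T x)) x =
      (\<Sum>i\<in>UNIV. \<Sum>j\<in>UNIV. \<Sum>l\<in>UNIV. ?t i j * ?t i l * partial_deriv l (partial_deriv j f) (T x))"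
    by (simp add: laplacian_def)
  also have "\<dots> = (\<Sum>j\<in>UNIV. \<Sum>l\<in>UNIV. \<Sum>i\<in>UNIV. ?t i j * ?t i l * partial_deriv l (partial_deriv j f) (T x))"
    by (subst sum.swap, rule sum.cong[OF refl], rule sum.swap)
  also have "\<dots> = laplacian f (T x)"
    unfolding sum_distrib_right[symmetric] orth laplacian_def
    by (simp add: if_distrib[of "\<lambda>a. a * _"] cong: if_cong)
  finally show ?thesis .
qed

lemma spherical_harmonics_orthogonal_transformation:
  fixes T :: "real ^ 'd::finite \<Rightarrow> real ^ 'd"
  assumes f: "f \<in> spherical_harmonics k" and T: "orthogonal_transformation T"
  shows "(\<lambda>x. f (T x)) \<in> spherical_harmonics k"
proof -
  obtain g where g: "g \<in> homogeneous_polys k" "\<forall>x. laplacian g x = 0" "f = on_sphere g"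
    using f by (auto simp: spherical_harmonics_def)
  have "(\<lambda>x. f (T x)) = on_sphere (\<lambda>x. g (T x))"
    using orthogonal_transformation_norm[OF T] by (auto simp: g(3) on_sphere_def)
  moreover have "(\<lambda>x. g (T x)) \<in> homogeneous_polys k"
    by (rule homogeneous_polys_linear[OF g(1) orthogonal_transformation_linear[OF T]])
  moreover have "laplacian (\<lambda>x. g (T x)) x = 0" for x
    by (simp add: laplacian_orthogonal_transformation[OF g(1) T] g(2))
  ultimately show ?thesis
    unfolding spherical_harmonics_def by (intro image_eqI[of _ _ "\<lambda>x. g (T x)"] CollectI conjI allI)
qed

lemma continuous_on_spherical_harmonics:
  assumes "f \<in> spherical_harmonics k"
  shows "continuous_on (sphere 0 1) f"
proof -
  obtain g where g: "g \<in> homogeneous_polys k" "f = on_sphere g"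
    using assms by (auto simp: spherical_harmonics_def)
  have "continuous_on (sphere 0 1) g"
    using homogeneous_polys_differentiable[OF g(1)]
    by (intro differentiable_imp_continuous_on) (auto simp: differentiable_on_def intro: differentiable_at_withinI)
  then show ?thesis
    by (rule continuous_on_eq) (simp add: g(2) on_sphere_def)
qed

lemma orthonormal_basis_on_expand:
  assumes "orthonormal_basis_on ip V J b" "finite J" "v \<in> V"
  obtains a where "v = (\<Sum>j\<in>J. a j *\<^sub>R b j)"
proof -
  have inj: "inj_on b J" and v: "v \<in> span (b ` J)"
    using assms by (auto simp: orthonormal_basis_on_def)
  then obtain u where "v = (\<Sum>w\<in>b ` J. u w *\<^sub>R w)"
    using assms(2) by (auto simp: span_finite)
  with inj that[of "\<lambda>j. u (b j)"] show ?thesis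
    by (simp add: sum.reindex)
qed

lemma orthonormal_basis_on_mem:
  "orthonormal_basis_on ip V J b \<Longrightarrow> j \<in> J \<Longrightarrow> b j \<in> V"
  by (auto simp: orthonormal_basis_on_def intro: span_base)

lemma sphere_L2_inner_sum:
  fixes b :: "'i \<Rightarrow> real ^ 'd::finite \<Rightarrow> real"
  assumes J: "finite J" and b: "\<And>j. j \<in> J \<Longrightarrow> continuous_on (sphere 0 1) (b j)"
    and orth: "\<And>i j. i \<in> J \<Longrightarrow> j \<in> J \<Longrightarrow> sphere_L2_inner (b i) (b j) = (if i = j then 1 else 0)"
  shows "sphere_L2_inner (\<lambda>x. \<Sum>j\<in>J. a j * b j x) (\<lambda>x. \<Sum>j\<in>J. a j * b j x) = (\<Sum>j\<in>J. (a j)\<^sup>2)"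
proof -
  have int: "integrable sphere_measure (\<lambda>x. a i * a j * (b i x * b j x))" if "i \<in> J" "j \<in> J" for i j
    using that by (intro integrable_sphere_measure continuous_intros b)
  have "sphere_L2_inner (\<lambda>x. \<Sum>j\<in>J. a j * b j x) (\<lambda>x. \<Sum>j\<in>J. a j * b j x) =
      (\<integral>x. (\<Sum>i\<in>J. \<Sum>j\<in>J. a i * a j * (b i x * b j x)) \<partial>sphere_measure)"
    unfolding sphere_L2_inner_def sum_product by (simp add: mult_ac)
  also have "\<dots> = (\<Sum>i\<in>J. \<Sum>j\<in>J. a i * a j * sphere_L2_inner (b i) (b j))"
  proof -
    have "(\<integral>x. (\<Sum>i\<in>J. \<Sum>j\<in>J. a i * a j * (b i x * b j x)) \<partial>sphere_measure) =
        (\<Sum>i\<in>J. \<integral>x. (\<Sum>j\<in>J. a i * a j * (b i x * b j x)) \<partial>sphere_measure)"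
      by (intro Bochner_Integration.integral_sum Bochner_Integration.integrable_sum int)
    also have "\<dots> = (\<Sum>i\<in>J. \<Sum>j\<in>J. \<integral>x. a i * a j * (b i x * b j x) \<partial>sphere_measure)"
      by (intro sum.cong refl Bochner_Integration.integral_sum int)
    finally show ?thesis
      unfolding sphere_L2_inner_def by simp
  qed
  also have "\<dots> = (\<Sum>i\<in>J. \<Sum>j\<in>J. if j = i then a i * a j else 0)"
    by (intro sum.cong) (auto simp: orth)
  also have "\<dots> = (\<Sum>j\<in>J. (a j)\<^sup>2)"
    using J by (simp add: power2_eq_square)
  finally show ?thesis .
qed

text \<open>\<open>(\<Sum>l\<in>L. (Y l y)\<^sup>2)\<close> is the largest value at \<open>y\<close> of the square of a
  harmonic of norm at most one, hence it is unchanged by rotations.\<close>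

lemma sum_harmonics_square_le_rotated:
  fixes Y :: "nat \<Rightarrow> real ^ 'd::finite \<Rightarrow> real"
  assumes Y: "orthonormal_basis_on sphere_L2_inner (spherical_harmonics k) L Y" and L: "finite L"
    and T: "orthogonal_transformation T"
  shows "(\<Sum>l\<in>L. (Y l y)\<^sup>2) \<le> (\<Sum>l\<in>L. (Y l (T y))\<^sup>2)" (is "?Z y \<le> ?Z (T y)")
proof -
  have cont: "continuous_on (sphere 0 1) (Y l)" if "l \<in> L" for l
    using orthonormal_basis_on_mem[OF Y that] by (rule continuous_on_spherical_harmonics)
  have orth: "sphere_L2_inner (Y i) (Y j) = (if i = j then 1 else 0)" if "i \<in> L" "j \<in> L" for i j
    using Y that by (simp add: orthonormal_basis_on_def)
  \<comment> \<open>\<open>f\<close> is the reproducing kernel at \<open>y\<close>: its value at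
    \<open>y\<close> and its squared norm are both \<open>?Z y\<close>. The rotated copy
    \<open>g\<close> below keeps the norm and takes that value at \<open>T y\<close>.\<close>
  define f where "f = (\<lambda>x. \<Sum>l\<in>L. Y l y * Y l x)"
  have "f = (\<Sum>l\<in>L. Y l y *\<^sub>R Y l)"
    by (simp add: f_def fun_eq_iff sum_fun_apply)
  also have "\<dots> \<in> span (Y ` L)"
    by (intro span_sum span_scale span_base) auto
  also have "span (Y ` L) = spherical_harmonics k"
    using Y by (simp add: orthonormal_basis_on_def)
  finally have f: "f \<in> spherical_harmonics k" .
  note iT = orthogonal_transformation_inv[OF T]
  define g where "g = (\<lambda>x. f (inv T x))"
  have "g \<in> spherical_harmonics k"
    unfolding g_def by (rule spherical_harmonics_orthogonal_transformation[OF f iT])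
  then obtain a where "g = (\<Sum>l\<in>L. a l *\<^sub>R Y l)"
    by (rule orthonormal_basis_on_expand[OF Y L])
  then have g: "g = (\<lambda>x. \<Sum>l\<in>L. a l * Y l x)"
    by (simp add: fun_eq_iff sum_fun_apply)
  have "(\<Sum>l\<in>L. (a l)\<^sup>2) = sphere_L2_inner g g"
    unfolding g by (rule sphere_L2_inner_sum[OF L cont orth, symmetric])
  also have "\<dots> = sphere_L2_inner f f"
    unfolding g_def using continuous_on_spherical_harmonics[OF f]
    by (intro sphere_L2_inner_orthogonal_transformation[OF iT])
  also have "\<dots> = ?Z y"
    unfolding f_def by (rule sphere_L2_inner_sum[OF L cont orth])
  finally have a: "(\<Sum>l\<in>L. (a l)\<^sup>2) = ?Z y" .
  have "?Z y = g (T y)"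
    using orthogonal_transformation_inj[OF T] by (simp add: g_def f_def power2_eq_square)
  \<comment> \<open>Cauchy-Schwarz for the coefficients of \<open>g\<close>, whose squares sum to
    \<open>?Z y\<close>; one factor \<open>?Z y\<close> cancels unless it is zero, when the claim is
    trivial.\<close>
  then have "(?Z y)\<^sup>2 = (\<Sum>l\<in>L. a l * Y l (T y))\<^sup>2"
    by (simp add: g)
  also have "\<dots> \<le> ?Z y * ?Z (T y)"
    unfolding a[symmetric] by (rule Cauchy_Schwarz_ineq_sum)
  finally have "?Z y * ?Z y \<le> ?Z y * ?Z (T y)"
    by (simp add: power2_eq_square)
  moreover have "?Z y \<ge> 0" "?Z (T y) \<ge> 0"
    by (simp_all add: sum_nonneg)
  ultimately show ?thesis
    by (cases "?Z y = 0") auto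
qed

text \<open>Rotations act transitively on the sphere, so the inequality above, used in both
  directions, makes the sum constant. Its integral counts the orthonormal functions.\<close>

lemma sum_orthonormal_harmonics_square:
  fixes Y :: "nat \<Rightarrow> real ^ 'd::finite \<Rightarrow> real"
  assumes Y: "orthonormal_basis_on sphere_L2_inner (spherical_harmonics k) L Y" and L: "finite L"
    and y: "y \<in> sphere 0 1"
  shows "2 * pi powr (real CARD('d) / 2) / Gamma (real CARD('d) / 2) * (\<Sum>l\<in>L. (Y l y)\<^sup>2) = real (card L)"
proof -
  have cont: "continuous_on (sphere 0 1) (Y l)" if "l \<in> L" for l
    using orthonormal_basis_on_mem[OF Y that] by (rule continuous_on_spherical_harmonics)
  have le: "(\<Sum>l\<in>L. (Y l y)\<^sup>2) \<le> (\<Sum>l\<in>L. (Y l z)\<^sup>2)"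
    if "y \<in> sphere 0 1" "z \<in> sphere 0 1" for y z
  proof -
    obtain T where "orthogonal_transformation T" "T y = z"
      using orthogonal_transformation_exists_1[of y z] \<open>y \<in> sphere 0 1\<close> \<open>z \<in> sphere 0 1\<close> by auto
    with sum_harmonics_square_le_rotated[OF Y L, of T y] show ?thesis
      by simp
  qed
  have "real (card L) = (\<Sum>l\<in>L. sphere_L2_inner (Y l) (Y l))"
    using Y by (simp add: orthonormal_basis_on_def)
  also have "\<dots> = (\<integral>z. (\<Sum>l\<in>L. (Y l z)\<^sup>2) \<partial>sphere_measure)"
    unfolding sphere_L2_inner_def power2_eq_square
    by (intro Bochner_Integration.integral_sum[symmetric] integrable_sphere_measure continuous_intros cont)
  also have "\<dots> = (\<integral>z. (\<Sum>l\<in>L. (Y l y)\<^sup>2) \<partial>(sphere_measure :: (real ^ 'd) measure))"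
    by (intro Bochner_Integration.integral_cong refl antisym le y) auto
  finally show ?thesis
    by (simp add: measure_sphere_measure_total)
qed

section \<open>Independence of point evaluations\<close>

text \<open>\<open>fejer n t\<close> is \<open>(1 - T n t) / (1 - t)\<close> for the Chebyshev polynomial \<open>T n\<close>; the
  recurrence is the one of \<open>T n\<close> divided by \<open>1 - t\<close>.\<close>

fun fejer :: "nat \<Rightarrow> real \<Rightarrow> real" where
  "fejer 0 t = 0"
| "fejer (Suc 0) t = 1"
| "fejer (Suc (Suc n)) t = 2 * t * fejer (Suc n) t - fejer n t + 2"

text \<open>By the recurrence for \<open>cos (n * \<theta>)\<close>. For
  \<open>cos \<theta> \<noteq> 1\<close> this exhibits the value as the square of
  \<open>sin (n * \<theta> / 2) / sin (\<theta> / 2)\<close>, the Fejer kernel up to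
  normalisation.\<close>

lemma fejer_cos: "(1 - cos \<theta>) * fejer n (cos \<theta>) = 1 - cos (real n * \<theta>)"
proof (induction n rule: induct_nat_012)
  case (ge2 n)
  have "cos (a + \<theta>) = 2 * cos \<theta> * cos a - cos (a - \<theta>)" for a
    by (simp add: cos_add cos_diff)
  from this[of "real (Suc n) * \<theta>"]
  have "cos (real (Suc (Suc n)) * \<theta>) = 2 * cos \<theta> * cos (real (Suc n) * \<theta>) - cos (real n * \<theta>)"
    by (simp add: algebra_simps)
  moreover have "(1 - cos \<theta>) * fejer (Suc (Suc n)) (cos \<theta>) =
      2 * cos \<theta> * ((1 - cos \<theta>) * fejer (Suc n) (cos \<theta>)) -
      (1 - cos \<theta>) * fejer n (cos \<theta>) + 2 * (1 - cos \<theta>)"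
    by (simp add: algebra_simps)
  ultimately show ?case
    by (simp only: ge2) (simp add: algebra_simps)
qed simp_all

text \<open>The peak value, which normalises the kernel. It comes from the recurrence because the
  trigonometric identity degenerates at \<open>\<theta> = 0\<close>.\<close>

lemma fejer_one: "fejer n 1 = (real n)\<^sup>2"
  by (induction n rule: induct_nat_012) (simp_all add: power2_eq_square algebra_simps)

text \<open>The index exceeds the degree by one because a factor \<open>1 - t\<close> has been
  divided out.\<close>

lemma fejer_inner_in_polys_deg_le: "(\<lambda>y. fejer (Suc n) (a \<bullet> y)) \<in> polys_deg_le n"
proof (induction n rule: induct_nat_012)
  case 1
  have "(\<lambda>y. 2 * (a \<bullet> y) + 2) \<in> polys_deg_le 1"
    by (intro subspace_addI subspace_multI inner_in_polys_deg_le const_in_polys_deg_le) simp_all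
  then show ?case
    by simp
next
  case (ge2 n)
  have "(\<lambda>y. (a \<bullet> y) * fejer (Suc (Suc n)) (a \<bullet> y)) \<in> polys_deg_le (1 + Suc n)"
    by (intro polys_deg_le_mult inner_in_polys_deg_le ge2) simp
  moreover have "(\<lambda>y. fejer (Suc n) (a \<bullet> y)) \<in> polys_deg_le (1 + Suc n)"
    using ge2(1) polys_deg_le_mono[of n "1 + Suc n"] by auto
  ultimately have "(\<lambda>y. 2 * ((a \<bullet> y) * fejer (Suc (Suc n)) (a \<bullet> y)) +
      ((-1) * fejer (Suc n) (a \<bullet> y) + 2)) \<in> polys_deg_le (1 + Suc n)"
    by (intro subspace_addI subspace_multI const_in_polys_deg_le subspace_polys_deg_le)
  then show ?case
    by (simp add: algebra_simps)
qed (simp add: const_in_polys_deg_le)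

lemma dist_sphere_square:
  fixes x y :: "'a::real_inner"
  assumes "norm x = 1" "norm y = 1"
  shows "(dist x y)\<^sup>2 = 2 - 2 * (x \<bullet> y)"
  using assms by (simp add: dist_norm power2_norm_eq_inner inner_diff inner_commute norm_eq_1)

lemma inner_sphere_abs_le:
  fixes x y :: "'a::real_inner"
  assumes "norm x = 1" "norm y = 1"
  shows "\<bar>x \<bullet> y\<bar> \<le> 1"
  using Cauchy_Schwarz_ineq2[of x y] assms by simp

text \<open>The squared chord is \<open>2 * (1 - cos \<theta>)\<close>, so the left side is twice
  the absolute value of \<open>1 - cos (n * \<theta>)\<close>. The bound is uniform in
  \<open>n\<close>, while the peak grows quadratically.\<close>

lemma fejer_decay:
  fixes x y :: "'a::real_inner"
  assumes "norm x = 1" "norm y = 1"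
  shows "(dist x y)\<^sup>2 * \<bar>fejer n (x \<bullet> y)\<bar> \<le> 4"
proof -
  define \<theta> where "\<theta> = arccos (x \<bullet> y)"
  have cos: "cos \<theta> = x \<bullet> y"
    using inner_sphere_abs_le[OF assms] by (simp add: \<theta>_def cos_arccos_abs)
  have "(dist x y)\<^sup>2 * \<bar>fejer n (x \<bullet> y)\<bar> = 2 * \<bar>(1 - cos \<theta>) * fejer n (cos \<theta>)\<bar>"
    unfolding dist_sphere_square[OF assms] cos[symmetric] abs_mult
    by (simp add: algebra_simps)
  also have "\<dots> \<le> 4"
  proof -
    have "\<bar>1 - cos (real n * \<theta>)\<bar> \<le> 2"
      using abs_cos_le_one[of "real n * \<theta>"] by linarith
    then show ?thesis
      unfolding fejer_cos using mult_left_mono[of "\<bar>1 - cos (real n * \<theta>)\<bar>" 2 2] by simp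
  qed
  finally show ?thesis .
qed

text \<open>Volume comparison: balls of radius \<open>\<delta> / 2\<close> around the points are
  disjoint and lie in the ball of radius \<open>R + \<delta> / 2\<close> around
  \<open>a\<close>.\<close>

lemma card_separated_le:
  fixes S :: "'a::euclidean_space set"
  assumes S: "finite S" and "\<delta> > 0" "R \<ge> 0"
    and sep: "\<And>x y. x \<in> S \<Longrightarrow> y \<in> S \<Longrightarrow> x \<noteq> y \<Longrightarrow> \<delta> \<le> dist x y"
    and R: "\<And>x. x \<in> S \<Longrightarrow> dist a x \<le> R"
  shows "real (card S) \<le> ((2 * R + \<delta>) / \<delta>) ^ DIM('a)"
proof -
  let ?v = "measure lborel (ball (0 :: 'a) 1)"
  have v: "?v > 0"
    by (rule content_ball_pos) simp
  have "real (card S) * ((\<delta> / 2) ^ DIM('a) * ?v) = (\<Sum>x\<in>S. measure lborel (ball x (\<delta> / 2)))"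
    using \<open>\<delta> > 0\<close> by (simp add: content_ball_conv_unit_ball[of "\<delta> / 2"])
  also have "\<dots> = measure lborel (\<Union>x\<in>S. ball x (\<delta> / 2))"
  proof (rule measure_UNION'[symmetric, OF S])
    show "pairwise (\<lambda>i j. disjnt (ball i (\<delta> / 2)) (ball j (\<delta> / 2))) S"
      unfolding pairwise_def
    proof (intro ballI impI)
      fix x y assume "x \<in> S" "y \<in> S" "x \<noteq> y"
      then have "\<delta> \<le> dist x y"
        by (rule sep)
      moreover have "dist x y < \<delta>" if "dist x z < \<delta> / 2" "dist y z < \<delta> / 2" for z
        using that dist_triangle2[of x y z] by linarith
      ultimately show "disjnt (ball x (\<delta> / 2)) (ball y (\<delta> / 2))"
        by (force simp: disjnt_def)
    qed
  qed (auto intro: fmeasurableI emeasure_lborel_ball_finite)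
  also have "\<dots> \<le> measure lborel (ball a (R + \<delta> / 2))"
  proof (rule measure_mono_fmeasurable)
    have "dist a z < R + \<delta> / 2" if "x \<in> S" "dist x z < \<delta> / 2" for x z
      using R[OF that(1)] that(2) dist_triangle[of a z x] by linarith
    then show "(\<Union>x\<in>S. ball x (\<delta> / 2)) \<subseteq> ball a (R + \<delta> / 2)"
      by auto
  qed (use S in \<open>auto intro: fmeasurableI emeasure_lborel_ball_finite\<close>)
  also have "\<dots> = (R + \<delta> / 2) ^ DIM('a) * ?v"
    using assms(2,3) by (intro content_ball_conv_unit_ball) simp
  finally have "real (card S) * (\<delta> / 2) ^ DIM('a) \<le> (R + \<delta> / 2) ^ DIM('a)"
    using v by (simp add: mult.assoc[symmetric])
  then have "real (card S) \<le> (R + \<delta> / 2) ^ DIM('a) / (\<delta> / 2) ^ DIM('a)"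
    using \<open>\<delta> > 0\<close> by (simp add: pos_le_divide_eq)
  also have "\<dots> = ((R + \<delta> / 2) / (\<delta> / 2)) ^ DIM('a)"
    by (simp only: power_divide)
  also have "(R + \<delta> / 2) / (\<delta> / 2) = (2 * R + \<delta>) / \<delta>"
    using \<open>\<delta> > 0\<close> by (simp add: field_simps)
  finally show ?thesis .
qed

lemma ex_power_two_interval:
  fixes r :: real
  assumes "r \<ge> 1"
  obtains n where "2 ^ n \<le> r" "r < 2 ^ Suc n"
proof -
  have "nat \<lfloor>r\<rfloor> \<ge> 1"
    using assms by linarith
  then obtain n where n: "2 ^ n \<le> nat \<lfloor>r\<rfloor>" "nat \<lfloor>r\<rfloor> < 2 ^ (n + 1)"
    using ex_power_ivl1[of 2 "nat \<lfloor>r\<rfloor>"] by auto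
  have "real (2 ^ n) \<le> real (nat \<lfloor>r\<rfloor>)"
    using n(1) by (simp only: of_nat_le_iff)
  also have "\<dots> \<le> r"
    using assms by simp
  finally have 1: "2 ^ n \<le> r"
    by simp
  have "r < real (nat \<lfloor>r\<rfloor>) + 1"
    using assms by linarith
  also have "\<dots> \<le> real (2 ^ (n + 1))"
    using n(2) by linarith
  finally show ?thesis
    using that 1 by simp
qed

text \<open>The points are sorted into dyadic shells by \<open>e\<close>, so that
  \<open>dist a x / \<delta>\<close> lies between \<open>2 ^ e x\<close> and twice that. In each
  shell the packing bound is multiplied by the largest possible summand, and the products are
  dominated by a geometric series. The summands are the kernel bounds that arise when
  \<open>L * \<delta> > 5\<close>.\<close>

lemma sum_separated_decay_less_one:
  fixes S :: "'a::euclidean_space set"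
  assumes S: "finite S" and \<delta>: "\<delta> > 0" and d: "DIM('a) \<ge> 2"
    and sep: "\<And>x y. x \<in> S \<Longrightarrow> y \<in> S \<Longrightarrow> x \<noteq> y \<Longrightarrow> \<delta> \<le> dist x y"
    and a: "\<And>x. x \<in> S \<Longrightarrow> \<delta> \<le> dist a x"
  shows "(\<Sum>x\<in>S. (4 * \<delta>\<^sup>2 / (25 * (dist a x)\<^sup>2)) ^ DIM('a)) < 1"
proof -
  let ?f = "\<lambda>x. (4 * \<delta>\<^sup>2 / (25 * (dist a x)\<^sup>2)) ^ DIM('a)"
  have "\<exists>n. 2 ^ n \<le> dist a x / \<delta> \<and> dist a x / \<delta> < 2 ^ Suc n" if "x \<in> S" for x
    using ex_power_two_interval[of "dist a x / \<delta>"] a[OF that] \<delta> by fastforce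
  then obtain e where e: "\<And>x. x \<in> S \<Longrightarrow> 2 ^ e x \<le> dist a x / \<delta>"
      "\<And>x. x \<in> S \<Longrightarrow> dist a x / \<delta> < 2 ^ Suc (e x)"
    by metis
  have shell: "(\<Sum>x\<in>{x\<in>S. e x = n}. ?f x) \<le> 16 / 25 * (1 / 4) ^ n" for n
  proof -
    have "?f x \<le> (4 / 25 / 4 ^ n) ^ DIM('a)" if "x \<in> S" "e x = n" for x
    proof -
      have "2 ^ n * \<delta> \<le> dist a x"
        using e(1)[OF that(1)] that(2) \<delta> by (simp add: field_simps)
      then have "(2 ^ n * \<delta>)\<^sup>2 \<le> (dist a x)\<^sup>2"
        using \<delta> by (intro power_mono) auto
      then have le: "4 ^ n * \<delta>\<^sup>2 \<le> (dist a x)\<^sup>2"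
        by (simp add: power_mult_distrib power2_eq_square[of "2 ^ n"] power_mult_distrib[symmetric])
      moreover have "0 < 4 ^ n * \<delta>\<^sup>2"
        using \<delta> by simp
      ultimately have "(dist a x)\<^sup>2 > 0"
        by linarith
      with le \<open>0 < 4 ^ n * \<delta>\<^sup>2\<close> have "4 * \<delta>\<^sup>2 / (25 * (dist a x)\<^sup>2) \<le> 4 / 25 / 4 ^ n"
        by (simp add: divide_simps mult_ac)
      then show ?thesis
        by (intro power_mono) simp_all
    qed
    then have "(\<Sum>x\<in>{x\<in>S. e x = n}. ?f x) \<le> real (card {x\<in>S. e x = n}) * (4 / 25 / 4 ^ n) ^ DIM('a)"
      by (intro sum_bounded_above) auto
    also have "real (card {x\<in>S. e x = n}) \<le> ((2 * (2 ^ Suc n * \<delta>) + \<delta>) / \<delta>) ^ DIM('a)"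
    proof (rule card_separated_le)
      show "dist a x \<le> 2 ^ Suc n * \<delta>" if "x \<in> {x\<in>S. e x = n}" for x
        using e(2)[of x] that \<delta> by (auto simp: field_simps)
    qed (use S \<delta> sep in auto)
    also have "(2 * (2 ^ Suc n * \<delta>) + \<delta>) / \<delta> = 4 * 2 ^ n + 1"
      using \<delta> by (simp add: field_simps)
    also have "(4 * 2 ^ n + 1 :: real) ^ DIM('a) \<le> (5 * 2 ^ n) ^ DIM('a)"
      by (intro power_mono) simp_all
    also have "(5 * 2 ^ n :: real) ^ DIM('a) * (4 / 25 / 4 ^ n) ^ DIM('a) = (4 / 5 / 2 ^ n) ^ DIM('a)"
    proof -
      have "(4 :: real) ^ n = 2 ^ n * 2 ^ n"
        by (simp flip: power_mult_distrib)
      then have "5 * 2 ^ n * (4 / 25 / 4 ^ n) = (4 / 5 / 2 ^ n :: real)"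
        by (simp add: field_simps)
      then show ?thesis
        by (simp only: power_mult_distrib[symmetric])
    qed
    \<comment> \<open>The dimension is at least 2 and the base at most 1. The exponent 2 is enough
      for the final sum, whereas exponent 1 would give the total \<open>8 / 5\<close>.\<close>
    also have "\<dots> \<le> (4 / 5 / 2 ^ n) ^ 2"
    proof (rule power_decreasing[OF d])
      have "(1 :: real) \<le> 2 ^ n"
        by simp
      then have "4 \<le> 5 * (2 :: real) ^ n"
        by linarith
      then show "4 / 5 / 2 ^ n \<le> (1 :: real)"
        by (simp add: divide_simps)
    qed simp
    also have "\<dots> = 16 / 25 * (1 / 4) ^ n"
      by (simp add: power_divide power_mult[symmetric] mult.commute[of n 2]) (simp add: power_mult)
    finally show ?thesis
      by (simp add: mult_right_mono)
  qed
  have "(\<Sum>x\<in>S. ?f x) = (\<Sum>n\<in>e ` S. \<Sum>x\<in>{x\<in>S. e x = n}. ?f x)"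
    by (rule sum.image_gen[OF S])
  also have "\<dots> \<le> (\<Sum>n\<in>e ` S. 16 / 25 * (1 / 4) ^ n)"
    by (rule sum_mono) (rule shell)
  also have "\<dots> \<le> (\<Sum>n. 16 / 25 * (1 / 4) ^ n)"
    using S by (intro sum_le_suminf summable_mult summable_geometric) auto
  also have "\<dots> = 16 / 25 * (\<Sum>n. (1 / 4) ^ n)"
    by (rule suminf_mult) simp
  \<comment> \<open>The geometric series equals \<open>4 / 3\<close>, so the total is
    \<open>64 / 75\<close>.\<close>
  also have "\<dots> < (1 :: real)"
    by (simp add: suminf_geometric)
  finally show ?thesis .
qed

text \<open>Test the functional with the power \<open>K\<close> of the Fejer kernel centred at a point
  where \<open>c\<close> is largest in absolute value: the other terms cannot compensate that one.\<close>

lemma separated_evaluations_independent: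
  fixes S :: "(real ^ 'd::finite) set"
  assumes S: "finite S" "S \<subseteq> sphere 0 1" and \<delta>: "\<delta> > 0" and d: "CARD('d) \<ge> 2"
    and sep: "\<And>x y. x \<in> S \<Longrightarrow> y \<in> S \<Longrightarrow> x \<noteq> y \<Longrightarrow> \<delta> \<le> dist x y"
    and m: "real m * \<delta> \<ge> 5 * real CARD('d)"
    and c: "\<And>f. f \<in> polys_deg_le m \<Longrightarrow> (\<Sum>x\<in>S. c x * f x) = 0"
    and x: "x \<in> S"
  shows "c x = 0"
proof (rule ccontr)
  assume "c x \<noteq> 0"
  let ?d = "CARD('d)"
  define C where "C = Max ((\<lambda>x. \<bar>c x\<bar>) ` S)"
  have "C \<in> (\<lambda>x. \<bar>c x\<bar>) ` S"
    unfolding C_def using S(1) x by (intro Max_in) auto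
  then obtain a where a: "a \<in> S" "\<bar>c a\<bar> = C"
    by auto
  have C: "\<bar>c y\<bar> \<le> C" if "y \<in> S" for y
    unfolding C_def using S(1) that by (intro Max_ge) auto
  have "C > 0"
    using C[OF x] \<open>c x \<noteq> 0\<close> by linarith
  \<comment> \<open>\<open>fejer L\<close> has degree \<open>m div ?d\<close>, so its
    \<open>?d\<close>-th power still has degree at most \<open>m\<close>. In \<open>K\<close> it is
    scaled to take the value 1 at \<open>a\<close>.\<close>
  define L where "L = Suc (m div ?d)"
  define K where "K y = (fejer L (a \<bullet> y) / (real L)\<^sup>2) ^ ?d" for y
  have norm: "norm y = 1" if "y \<in> S" for y
    using S(2) that by auto
  have "(\<lambda>y. (1 / (real L)\<^sup>2) * fejer L (a \<bullet> y)) \<in> polys_deg_le (m div ?d)"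
    unfolding L_def by (intro subspace_multI fejer_inner_in_polys_deg_le) simp
  then have "K \<in> polys_deg_le (?d * (m div ?d))"
    using polys_deg_le_power[of _ "m div ?d" ?d] by (simp add: K_def[abs_def])
  then have "K \<in> polys_deg_le m"
    using polys_deg_le_mono[of "?d * (m div ?d)" m] by auto
  then have "(\<Sum>y\<in>S. c y * K y) = 0"
    by (rule c)
  moreover have "K a = 1"
    using norm[OF a(1)] by (simp add: K_def norm_eq_1 fejer_one L_def)
  ultimately have "c a = - (\<Sum>y\<in>S-{a}. c y * K y)"
    using S(1) a(1) by (simp add: sum.remove)
  then have "C \<le> (\<Sum>y\<in>S-{a}. \<bar>c y * K y\<bar>)"
    using a(2) sum_abs[of "\<lambda>y. c y * K y" "S - {a}"] by simp
  also have "\<dots> \<le> (\<Sum>y\<in>S-{a}. C * (4 * \<delta>\<^sup>2 / (25 * (dist a y)\<^sup>2)) ^ ?d)"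
  proof (rule sum_mono)
    fix y assume y: "y \<in> S - {a}"
    then have dist: "dist a y > 0"
      by auto
    \<comment> \<open>The \<open>Suc\<close> in \<open>L\<close> compensates for rounding in
      \<open>m div ?d\<close>: it gives \<open>m < ?d * L\<close>, hence
      \<open>L * \<delta> > 5\<close>, the source of the 25.\<close>
    have "real m < real (?d * L)"
      unfolding of_nat_less_iff L_def using dividend_less_times_div[of ?d m] by simp
    then have "real m * \<delta> < real (?d * L) * \<delta>"
      using \<delta> by (rule mult_strict_right_mono)
    also have "\<dots> = real ?d * (real L * \<delta>)"
      by simp
    finally have "real ?d * 5 < real ?d * (real L * \<delta>)"
      using m by linarith
    then have "5 < real L * \<delta>"
      by (rule mult_left_less_imp_less) simp
    then have L5: "25 \<le> (real L * \<delta>)\<^sup>2"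
      using power_mono[of 5 "real L * \<delta>" 2] by simp
    have "\<bar>fejer L (a \<bullet> y) / (real L)\<^sup>2\<bar> \<le> 4 / ((dist a y)\<^sup>2 * (real L)\<^sup>2)"
      using fejer_decay[of a y L] norm a(1) y dist by (simp add: field_simps L_def abs_mult)
    also have "\<dots> = 4 * \<delta>\<^sup>2 / ((real L * \<delta>)\<^sup>2 * (dist a y)\<^sup>2)"
      using \<delta> by (simp add: field_simps)
    also have "\<dots> \<le> 4 * \<delta>\<^sup>2 / (25 * (dist a y)\<^sup>2)"
      using L5 dist \<delta> by (intro divide_left_mono mult_right_mono mult_pos_pos) (auto simp: L_def)
    finally have "\<bar>K y\<bar> \<le> (4 * \<delta>\<^sup>2 / (25 * (dist a y)\<^sup>2)) ^ ?d"
      unfolding K_def power_abs by (intro power_mono) simp_all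
    then show "\<bar>c y * K y\<bar> \<le> C * (4 * \<delta>\<^sup>2 / (25 * (dist a y)\<^sup>2)) ^ ?d"
      using C[of y] y \<open>C > 0\<close> unfolding abs_mult by (intro mult_mono) auto
  qed
  also have "\<dots> = C * (\<Sum>y\<in>S-{a}. (4 * \<delta>\<^sup>2 / (25 * (dist a y)\<^sup>2)) ^ DIM(real ^ 'd))"
    by (simp add: sum_distrib_left)
  also have "\<dots> < C * 1"
    using S(1) \<delta> d sep a(1) \<open>C > 0\<close>
    by (intro mult_strict_left_mono sum_separated_decay_less_one) auto
  finally show False
    by simp
qed

text \<open>Jordan's inequality: by concavity, sine lies above its chord between 0 and
  \<open>pi / 2\<close>.\<close>

lemma sin_ge_linear:
  fixes u :: real
  assumes "0 \<le> u" "u \<le> pi / 2"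
  shows "2 * u / pi \<le> sin u"
proof -
  have "concave_on {0..pi / 2} sin"
    by (rule f''_le0_imp_concave[of _ _ cos "\<lambda>x. - sin x"])
       (auto intro!: derivative_eq_intros sin_ge_zero)
  from concave_onD[OF this, of "2 * u / pi" 0 "pi / 2"] assms show ?thesis
    by (simp add: field_simps)
qed

text \<open>The chord of an angle \<open>\<theta>\<close> is \<open>2 * sin (\<theta> / 2)\<close>,
  and Jordan's inequality bounds it below by \<open>2 * \<theta> / pi\<close>.\<close>

lemma dist_ge_arccos:
  fixes x y :: "'a::real_inner"
  assumes "norm x = 1" "norm y = 1" "q > 0" "arccos (x \<bullet> y) > q"
  shows "2 * q / pi \<le> dist x y"
proof -
  define \<theta> where "\<theta> = arccos (x \<bullet> y)"
  have abs: "\<bar>x \<bullet> y\<bar> \<le> 1"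
    by (rule inner_sphere_abs_le[OF assms(1,2)])
  have \<theta>: "q < \<theta>" "\<theta> \<le> pi" "cos \<theta> = x \<bullet> y"
    using assms(4) abs by (auto simp: \<theta>_def cos_arccos_abs abs_le_iff intro: arccos_ubound)
  have "2 * q / pi \<le> 2 * (2 * (\<theta> / 2) / pi)"
    using \<theta>(1) by (simp add: divide_right_mono)
  also have "\<dots> \<le> 2 * sin (\<theta> / 2)"
    using \<theta>(1,2) \<open>q > 0\<close> by (intro mult_left_mono sin_ge_linear) auto
  finally have le: "2 * q / pi \<le> 2 * sin (\<theta> / 2)" .
  have "(dist x y)\<^sup>2 = 2 - 2 * cos (2 * (\<theta> / 2))"
    using dist_sphere_square[OF assms(1,2)] \<theta>(3) by simp
  also have "\<dots> = (2 * sin (\<theta> / 2))\<^sup>2"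
    unfolding cos_double_sin by (simp add: power_mult_distrib)
  finally have "(2 * q / pi)\<^sup>2 \<le> (dist x y)\<^sup>2"
    using le \<open>q > 0\<close> by (simp only:) (intro power_mono, simp_all)
  then show ?thesis
    by (rule power2_le_imp_le) simp
qed

section \<open>Coordinate spaces\<close>

lemma coord_inner_add_left: "coord_inner I (u + v) w = coord_inner I u w + coord_inner I v w"
  by (simp add: coord_inner_def distrib_right sum.distrib)

lemma coord_inner_diff_left: "coord_inner I (u - v) w = coord_inner I u w - coord_inner I v w"
  by (simp add: coord_inner_def left_diff_distrib sum_subtractf)

lemma coord_inner_scaleR_left: "coord_inner I (c *\<^sub>R u) w = c * coord_inner I u w"
  by (simp add: coord_inner_def sum_distrib_left mult.assoc)

lemma coord_inner_commute: "coord_inner I u w = coord_inner I w u"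
  by (simp add: coord_inner_def mult.commute)

lemma coord_inner_sum_left:
  fixes b :: "'j \<Rightarrow> 'i \<Rightarrow> real" and c :: "'j \<Rightarrow> real"
  shows
  "coord_inner I (\<Sum>j\<in>J. c j *\<^sub>R b j) w = (\<Sum>j\<in>J. c j * coord_inner I (b j) w)"
  unfolding coord_inner_def sum_fun_apply
  by (simp add: sum_distrib_left sum_distrib_right mult.assoc) (rule sum.swap)

lemma subspace_coord_space: "subspace (coord_space I)"
  by (auto simp: subspace_def coord_space_def)

lemma coord_inner_self_eq_0:
  assumes "finite I" "coord_inner I v v = 0" "i \<in> I"
  shows "v i = 0"
  using assms by (simp add: coord_inner_def sum_nonneg_eq_0_iff)

lemma coord_inner_span_eq_0:
  fixes v :: "'i \<Rightarrow> real" and S :: "('i \<Rightarrow> real) set"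
  assumes "\<And>s. s \<in> S \<Longrightarrow> coord_inner I v s = 0" and u: "u \<in> span S"
  shows "coord_inner I v u = 0"
  using u
proof (induction rule: span_induct)
  case base
  show ?case
    by (auto simp: subspace_def coord_inner_def distrib_left sum.distrib mult.left_commute
        simp flip: sum_distrib_left)
qed (rule assms(1))

text \<open>Gram-Schmidt, one vector at a time: \<open>a\<close> is replaced by its part
  \<open>b\<close> orthogonal to \<open>S\<close>, and the projection of \<open>v\<close> is
  corrected along \<open>b\<close>.\<close>

lemma coord_projection_exists:
  fixes v :: "'i \<Rightarrow> real" and S :: "('i \<Rightarrow> real) set"
  assumes I: "finite I" and S: "finite S"
  shows "\<exists>u\<in>span S. \<forall>s\<in>S. coord_inner I (v - u) s = 0"
  using S
proof (induction S arbitrary: v rule: finite_induct)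
  case empty
  show ?case
    by (auto intro: span_zero)
next
  case (insert a S)
  obtain ua where ua: "ua \<in> span S" "\<forall>s\<in>S. coord_inner I (a - ua) s = 0"
    using insert.IH[of a] by blast
  obtain uv where uv: "uv \<in> span S" "\<forall>s\<in>S. coord_inner I (v - uv) s = 0"
    using insert.IH[of v] by blast
  define b where "b = a - ua"
  define t where "t = coord_inner I (v - uv) b / coord_inner I b b"
  define u where "u = uv + t *\<^sub>R b"
  have sub: "span S \<subseteq> span (insert a S)"
    by (rule span_mono) auto
  have "b \<in> span (insert a S)"
    unfolding b_def using ua(1) sub by (intro span_diff) (auto intro: span_base)
  then have "u \<in> span (insert a S)"
    unfolding u_def using uv(1) sub by (intro span_add span_scale) auto
  moreover have vu: "coord_inner I (v - u) w = coord_inner I (v - uv) w - t * coord_inner I b w" for w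
    unfolding u_def by (simp add: coord_inner_diff_left coord_inner_add_left coord_inner_scaleR_left)
  have orthS: "coord_inner I (v - u) s = 0" if "s \<in> S" for s
    using ua(2) uv(2) that by (simp add: vu b_def)
  have "coord_inner I (v - u) b = 0"
  \<comment> \<open>The form sees only coordinates in \<open>I\<close>, so \<open>b\<close> may have
    norm zero without being zero. It then vanishes on \<open>I\<close>, and the pairing is zero
    whatever \<open>t\<close> is.\<close>
  proof (cases "coord_inner I b b = 0")
    case True
    then have "b i = 0" if "i \<in> I" for i
      using coord_inner_self_eq_0[OF I] that by blast
    then show ?thesis
      by (simp add: coord_inner_def)
  next
    case False
    then show ?thesis
      by (simp add: vu t_def)
  qed
  moreover have "coord_inner I (v - u) ua = 0"
    using orthS ua(1) by (rule coord_inner_span_eq_0)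
  moreover have "coord_inner I (v - u) a = coord_inner I (v - u) b + coord_inner I (v - u) ua"
    by (simp add: b_def coord_inner_def sum.distrib[symmetric] algebra_simps)
  ultimately have "u \<in> span (insert a S) \<and> (\<forall>s\<in>insert a S. coord_inner I (v - u) s = 0)"
    using orthS by simp
  then show ?case
    by (intro bexI[of _ u]) (rule conjunct1 conjunct2, assumption)+
qed

text \<open>If \<open>u\<close> is the projection of \<open>v\<close> to the row space, then
  \<open>v - u\<close> lies in the kernel. It is therefore orthogonal to \<open>v\<close>, and also
  to \<open>u\<close>, hence to itself. Rows are cut off outside \<open>I\<close> so that they
  belong to \<open>coord_space I\<close>.\<close>

lemma orth_complement_matrix_kernel:
  fixes A :: "'j \<Rightarrow> 'i \<Rightarrow> real"
  assumes I: "finite I" and J: "finite J"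
  shows "orth_complement I (matrix_kernel J I A) \<subseteq> span ((\<lambda>j i. if i \<in> I then A j i else 0) ` J)"
    (is "_ \<subseteq> span (?r ` J)")
proof
  fix v assume v: "v \<in> orth_complement I (matrix_kernel J I A)"
  obtain u where u: "u \<in> span (?r ` J)" "\<forall>s\<in>?r ` J. coord_inner I (v - u) s = 0"
    using coord_projection_exists[OF I finite_imageI[OF J]] ..
  have "span (?r ` J) \<subseteq> coord_space I"
    by (rule span_minimal[OF _ subspace_coord_space]) (auto simp: coord_space_def)
  then have "u \<in> coord_space I"
    using u(1) by (rule subsetD)
  moreover have "v \<in> coord_space I"
    using v by (simp add: orth_complement_def)
  ultimately have vu: "v - u \<in> coord_space I"
    by (intro subspace_diff[OF subspace_coord_space])
  have "(\<Sum>i\<in>I. A j i * (v - u) i) = 0" if "j \<in> J" for j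
  proof -
    have "(\<Sum>i\<in>I. A j i * (v - u) i) = coord_inner I (v - u) (?r j)"
      unfolding coord_inner_def by (intro sum.cong refl) (simp add: mult.commute)
    also have "\<dots> = 0"
      using u(2) imageI[OF that] by (rule bspec)
    finally show ?thesis .
  qed
  then have "v - u \<in> matrix_kernel J I A"
    unfolding matrix_kernel_def using vu by (intro CollectI conjI ballI)
  then have "coord_inner I v (v - u) = 0"
    using v by (simp add: orth_complement_def)
  moreover have "coord_inner I (v - u) u = 0"
  proof (rule coord_inner_span_eq_0[OF _ u(1)])
    show "coord_inner I (v - u) s = 0" if "s \<in> ?r ` J" for s
      using u(2) that by (rule bspec)
  qed
  then have "coord_inner I u (v - u) = 0"
    by (rule trans[OF coord_inner_commute])
  ultimately have "coord_inner I (v - u) (v - u) = 0"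
    by (simp only: coord_inner_diff_left diff_self)
  then have "(v - u) i = 0" for i
    using coord_inner_self_eq_0[OF I, of "v - u" i] vu unfolding coord_space_def by blast
  then have "v = u"
    by (simp add: fun_eq_iff)
  with u(1) show "v \<in> span (?r ` J)"
    by simp
qed

lemma independent_imageI:
  fixes r :: "'a \<Rightarrow> 'v::real_vector"
  assumes S: "finite S"
    and zero: "\<forall>c. (\<Sum>x\<in>S. c x *\<^sub>R r x) = 0 \<longrightarrow> (\<forall>x\<in>S. c x = 0)"
  shows "inj_on r S" "independent (r ` S)"
proof -
  show inj: "inj_on r S"
  proof (rule inj_onI, rule ccontr)
    fix x y assume xy: "x \<in> S" "y \<in> S" "r x = r y" "x \<noteq> y"
    \<comment> \<open>Equal vectors at distinct indices give a relation with coefficients 1 and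
      -1.\<close>
    let ?c = "\<lambda>z. (if z = x then 1 else 0) - (if z = y then 1 else 0) :: real"
    have "(\<Sum>z\<in>S. ?c z *\<^sub>R r z) = (\<Sum>z\<in>S. if z = x then r z else 0) - (\<Sum>z\<in>S. if z = y then r z else 0)"
      unfolding sum_subtractf[symmetric] by (rule sum.cong) auto
    also have "\<dots> = 0"
      using S xy by simp
    finally have "?c x = 0"
      using zero[rule_format, of ?c x] xy(1) by simp
    with xy(4) show False
      by simp
  qed
  show "independent (r ` S)"
  proof (rule independent_if_scalars_zero)
    fix f v assume f: "(\<Sum>v\<in>r ` S. f v *\<^sub>R v) = 0" and "v \<in> r ` S"
    then obtain x where x: "x \<in> S" "v = r x"
      by blast
    from f have "(\<Sum>x\<in>S. f (r x) *\<^sub>R r x) = 0"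
      by (simp add: sum.reindex[OF inj])
    then show "f v = 0"
      using zero[rule_format, of "\<lambda>x. f (r x)" x] x by simp
  qed (use S in simp)
qed

text \<open>A vector of \<open>B\<close> outside \<open>span P\<close> would enlarge
  \<open>P\<close> to an independent set in \<open>span B\<close> with more elements than
  \<open>B\<close>.\<close>

lemma span_eq_if_card_eq:
  fixes P :: "'v::real_vector set"
  assumes B: "finite B" and P: "independent P" "P \<subseteq> span B" "card P = card B"
  shows "span P = span B"
proof
  show "span P \<subseteq> span B"
    using P(2) by (rule span_minimal) simp
  have fin: "finite P"
    using independent_span_bound[OF B P(1,2)] ..
  have "B \<subseteq> span P"
  proof (rule ccontr)
    assume "\<not> B \<subseteq> span P"
    then obtain w where w: "w \<in> B" "w \<notin> span P"
      by blast
    have "independent (insert w P)"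
      using w(2) P(1) by (rule independent_insertI)
    moreover have "insert w P \<subseteq> span B"
      using w(1) P(2) by (auto intro: span_base)
    ultimately have "card (insert w P) \<le> card B"
      using independent_span_bound[OF B] by blast
    moreover have "w \<notin> P"
      using w(2) span_base by blast
    ultimately show False
      using fin P(3) by simp
  qed
  then show "span B \<subseteq> span P"
    by (rule span_minimal) simp
qed

lemma coord_orthonormal_expand:
  fixes v :: "'i \<Rightarrow> real" and b :: "'j \<Rightarrow> 'i \<Rightarrow> real"
  assumes b: "orthonormal_basis_on (coord_inner I) (coord_space I) J b" and J: "finite J"
    and v: "v \<in> coord_space I"
  shows "v = (\<Sum>j\<in>J. coord_inner I (b j) v *\<^sub>R b j)"
    and "coord_inner I v v = (\<Sum>j\<in>J. (coord_inner I (b j) v)\<^sup>2)"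
proof -
  have orth: "coord_inner I (b i) (b j) = (if i = j then 1 else 0)" if "i \<in> J" "j \<in> J" for i j
    using b that by (simp add: orthonormal_basis_on_def)
  obtain a where a: "v = (\<Sum>j\<in>J. a j *\<^sub>R b j)"
    using orthonormal_basis_on_expand[OF b J v] .
  have coeff: "coord_inner I (b i) v = a i" if "i \<in> J" for i
  proof -
    have "coord_inner I (b i) v = (\<Sum>j\<in>J. if j = i then a j else 0)"
      unfolding coord_inner_commute[of I "b i"] a coord_inner_sum_left
      using that by (intro sum.cong) (auto simp: orth)
    with that J show ?thesis
      by simp
  qed
  have "(\<Sum>j\<in>J. coord_inner I (b j) v *\<^sub>R b j) = (\<Sum>j\<in>J. a j *\<^sub>R b j)"
    by (intro sum.cong refl) (simp only: coeff)
  then show v_eq: "v = (\<Sum>j\<in>J. coord_inner I (b j) v *\<^sub>R b j)"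
    using a by (rule trans[OF _ sym, symmetric])
  show "coord_inner I v v = (\<Sum>j\<in>J. (coord_inner I (b j) v)\<^sup>2)"
    by (subst (1) v_eq) (simp only: coord_inner_sum_left power2_eq_square)
qed

lemma polys_deg_le_on_sphere:
  assumes "f \<in> polys_deg_le n"
  shows "on_sphere f \<in> span (\<Union>k\<le>n. spherical_harmonics k)"
proof -
  obtain g where g: "\<And>k. k \<le> n \<Longrightarrow> g k \<in> homogeneous_polys k" "f = (\<lambda>x. \<Sum>k\<le>n. g k x)"
    using polys_deg_le_decompose[OF assms] by blast
  have "on_sphere f = (\<Sum>k\<le>n. on_sphere (g k))"
    by (simp add: g(2) fun_eq_iff on_sphere_def sum_fun_apply)
  also have "\<dots> \<in> span (\<Union>k\<le>n. spherical_harmonics k)"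
  proof (rule span_sum)
    fix k assume k: "k \<in> {..n}"
    have "on_sphere (g k) \<in> span (\<Union>i\<le>k. spherical_harmonics i)"
      using k by (intro homogeneous_poly_on_sphere g) simp
    also have "\<dots> \<subseteq> span (\<Union>i\<le>n. spherical_harmonics i)"
      using k by (intro span_mono UN_mono) auto
    finally show "on_sphere (g k) \<in> span (\<Union>i\<le>n. spherical_harmonics i)" .
  qed
  finally show ?thesis .
qed

section \<open>Rows of the spherical Fourier matrix\<close>

text \<open>At \<open>y = x j\<close> this is row \<open>j\<close> of the Fourier matrix. Admitting
  every \<open>y\<close> lets evaluation at an arbitrary point be compared with those rows; the
  value 0 off \<open>I\<close> places it in \<open>coord_space I\<close>.\<close>

definition harmonic_row ::
  "(nat \<times> nat) set \<Rightarrow> (nat \<Rightarrow> nat \<Rightarrow> real ^ 'd::finite \<Rightarrow> real) \<Rightarrow> real ^ 'd \<Rightarrow> nat \<times> nat \<Rightarrow> real" where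
  "harmonic_row I Y y = (\<lambda>i. if i \<in> I then Y (fst i) (snd i) y else 0)"

lemma harmonic_row_in_coord_space: "harmonic_row I Y y \<in> coord_space I"
  by (simp add: harmonic_row_def coord_space_def)

text \<open>The harmonics up to degree \<open>n\<close> span all restrictions of such polynomials,
  and each basis function is read off from the row by a unit vector. What matters is that
  \<open>v\<close> does not depend on \<open>y\<close>.\<close>

lemma polys_deg_le_coords:
  fixes Y :: "nat \<Rightarrow> nat \<Rightarrow> real ^ 'd::finite \<Rightarrow> real"
  assumes Y: "orthonormal_harmonics_family Y"
    and I: "I = (SIGMA k:{0..n}. {1..dim (spherical_harmonics k :: (real ^ 'd \<Rightarrow> real) set)})"
    and f: "f \<in> polys_deg_le n"
  shows "\<exists>v. \<forall>y\<in>sphere 0 1. f y = coord_inner I (harmonic_row I Y y) v"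
proof -
  let ?V = "{g. \<exists>v. \<forall>y\<in>sphere 0 1. g y = coord_inner I (harmonic_row I Y y) v}"
  have fin: "finite I"
    unfolding I by (intro finite_SigmaI) simp_all
  have sub: "subspace ?V"
  proof (rule subspace_CollectI)
    show "\<exists>v. \<forall>y\<in>sphere 0 1. 0 = coord_inner I (harmonic_row I Y y) v"
      by (rule exI[of _ "\<lambda>i. 0"]) (simp add: coord_inner_def)
  next
    fix g h :: "real ^ 'd \<Rightarrow> real"
    assume "\<exists>v. \<forall>y\<in>sphere 0 1. g y = coord_inner I (harmonic_row I Y y) v"
    then obtain v where v: "\<forall>y\<in>sphere 0 1. g y = coord_inner I (harmonic_row I Y y) v" ..
    assume "\<exists>v. \<forall>y\<in>sphere 0 1. h y = coord_inner I (harmonic_row I Y y) v"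
    then obtain w where w: "\<forall>y\<in>sphere 0 1. h y = coord_inner I (harmonic_row I Y y) w" ..
    show "\<exists>v. \<forall>y\<in>sphere 0 1. g y + h y = coord_inner I (harmonic_row I Y y) v"
      using v w by (intro exI[of _ "\<lambda>i. v i + w i"])
        (simp add: coord_inner_def distrib_left sum.distrib)
  next
    fix g :: "real ^ 'd \<Rightarrow> real" and c
    assume "\<exists>v. \<forall>y\<in>sphere 0 1. g y = coord_inner I (harmonic_row I Y y) v"
    then obtain v where v: "\<forall>y\<in>sphere 0 1. g y = coord_inner I (harmonic_row I Y y) v" ..
    show "\<exists>v. \<forall>y\<in>sphere 0 1. c * g y = coord_inner I (harmonic_row I Y y) v"
      using v by (intro exI[of _ "\<lambda>i. c * v i"])
        (simp add: coord_inner_def sum_distrib_left mult.left_commute)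
  qed
  have Yk: "Y k l \<in> ?V" if "k \<le> n" "l \<in> {1..dim (spherical_harmonics k :: (real ^ 'd \<Rightarrow> real) set)}" for k l
  proof -
    have kl: "(k, l) \<in> I"
      using that by (simp add: I)
    have "Y k l y = coord_inner I (harmonic_row I Y y) (\<lambda>i. if i = (k, l) then 1 else 0)" for y
    proof -
      have "coord_inner I (harmonic_row I Y y) (\<lambda>i. if i = (k, l) then 1 else 0) =
          (\<Sum>i\<in>I. if i = (k, l) then Y k l y else 0)"
        unfolding coord_inner_def harmonic_row_def by (intro sum.cong) auto
      with kl fin show ?thesis
        by simp
    qed
    then show ?thesis
      by (intro CollectI exI ballI)
  qed
  have "spherical_harmonics k \<subseteq> ?V" if "k \<le> n" for k
  proof -
    have "span (Y k ` {1..dim (spherical_harmonics k :: (real ^ 'd \<Rightarrow> real) set)}) \<subseteq> ?V"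
      using Yk[OF that] by (intro span_minimal sub) blast
    moreover have "span (Y k ` {1..dim (spherical_harmonics k :: (real ^ 'd \<Rightarrow> real) set)}) = spherical_harmonics k"
      using Y by (simp add: orthonormal_harmonics_family_def orthonormal_basis_on_def)
    ultimately show ?thesis
      by simp
  qed
  then have "span (\<Union>k\<le>n. spherical_harmonics k) \<subseteq> ?V"
    by (intro span_minimal sub UN_least) simp
  then have "on_sphere f \<in> ?V"
    using polys_deg_le_on_sphere[OF f] by (rule subsetD)
  then obtain v where "\<forall>y\<in>sphere 0 1. on_sphere f y = coord_inner I (harmonic_row I Y y) v"
    by (elim CollectE exE)
  then show ?thesis
    by (intro exI[of _ v]) (simp add: on_sphere_def)
qed

text \<open>The diagonal addition theorem, summed over the degrees.\<close>

lemma coord_inner_harmonic_row_self: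
  fixes Y :: "nat \<Rightarrow> nat \<Rightarrow> real ^ 'd::finite \<Rightarrow> real"
  assumes Y: "orthonormal_harmonics_family Y"
    and I: "I = (SIGMA k:{0..n}. {1..dim (spherical_harmonics k :: (real ^ 'd \<Rightarrow> real) set)})"
    and y: "y \<in> sphere 0 1"
  shows "2 * pi powr (real CARD('d) / 2) / Gamma (real CARD('d) / 2) *
      coord_inner I (harmonic_row I Y y) (harmonic_row I Y y) =
    real (\<Sum>k=0..n. dim (spherical_harmonics k :: (real ^ 'd \<Rightarrow> real) set))"
proof -
  let ?L = "\<lambda>k. {1..dim (spherical_harmonics k :: (real ^ 'd \<Rightarrow> real) set)}"
  let ?\<sigma> = "2 * pi powr (real CARD('d) / 2) / Gamma (real CARD('d) / 2)"
  have "coord_inner I (harmonic_row I Y y) (harmonic_row I Y y) = (\<Sum>(k, l)\<in>I. (Y k l y)\<^sup>2)"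
    unfolding coord_inner_def by (intro sum.cong) (auto simp: harmonic_row_def power2_eq_square)
  also have "\<dots> = (\<Sum>k=0..n. \<Sum>l\<in>?L k. (Y k l y)\<^sup>2)"
    unfolding I by (rule sum.Sigma[symmetric]) simp_all
  finally have "?\<sigma> * coord_inner I (harmonic_row I Y y) (harmonic_row I Y y) =
      (\<Sum>k=0..n. ?\<sigma> * (\<Sum>l\<in>?L k. (Y k l y)\<^sup>2))"
    by (simp add: sum_distrib_left)
  also have "\<dots> = (\<Sum>k=0..n. real (card (?L k)))"
    using Y y by (intro sum.cong refl sum_orthonormal_harmonics_square)
      (auto simp: orthonormal_harmonics_family_def)
  finally show ?thesis
    by simp
qed

lemma polys_deg_le_harmonic_row_combination:
  fixes Y :: "nat \<Rightarrow> nat \<Rightarrow> real ^ 'd::finite \<Rightarrow> real"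
  assumes Y: "orthonormal_harmonics_family Y"
    and I: "I = (SIGMA k:{0..n}. {1..dim (spherical_harmonics k :: (real ^ 'd \<Rightarrow> real) set)})"
    and S: "S \<subseteq> sphere 0 1" and f: "f \<in> polys_deg_le n"
  shows "(\<Sum>x\<in>S. c x *\<^sub>R harmonic_row I Y x) = 0 \<Longrightarrow> (\<Sum>x\<in>S. c x * f x) = 0"
    and "y \<in> sphere 0 1 \<Longrightarrow> harmonic_row I Y y = (\<Sum>x\<in>S. c x *\<^sub>R harmonic_row I Y x) \<Longrightarrow>
      f y = (\<Sum>x\<in>S. c x * f x)"
proof -
  obtain v where v: "\<forall>y\<in>sphere 0 1. f y = coord_inner I (harmonic_row I Y y) v"
    using polys_deg_le_coords[OF Y I f] ..
  have "(\<Sum>x\<in>S. c x * f x) = (\<Sum>x\<in>S. c x * coord_inner I (harmonic_row I Y x) v)"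
    using S v by (intro sum.cong refl) auto
  then have *: "(\<Sum>x\<in>S. c x * f x) = coord_inner I (\<Sum>x\<in>S. c x *\<^sub>R harmonic_row I Y x) v"
    by (simp add: coord_inner_sum_left)
  show "(\<Sum>x\<in>S. c x * f x) = 0" if "(\<Sum>x\<in>S. c x *\<^sub>R harmonic_row I Y x) = 0"
    unfolding * that by (simp add: coord_inner_def)
  show "f y = (\<Sum>x\<in>S. c x * f x)"
    if "y \<in> sphere 0 1" "harmonic_row I Y y = (\<Sum>x\<in>S. c x *\<^sub>R harmonic_row I Y x)"
    unfolding * that(2)[symmetric] using v that(1) by (rule bspec)
qed

text \<open>If evaluation at \<open>y\<close> is \<open>\<Sum>x\<in>S. c x * f x\<close> in degree \<open>Suc m\<close>, then comparing \<open>f\<close> with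
  \<open>h * f\<close> for linear \<open>h\<close> and \<open>f\<close> of degree \<open>m\<close> gives \<open>c x * (h x - h y) = 0\<close>.\<close>

lemma harmonic_row_in_span_imp_mem:
  fixes Y :: "nat \<Rightarrow> nat \<Rightarrow> real ^ 'd::finite \<Rightarrow> real"
  assumes Y: "orthonormal_harmonics_family Y"
    and I: "I = (SIGMA k:{0..Suc m}. {1..dim (spherical_harmonics k :: (real ^ 'd \<Rightarrow> real) set)})"
    and S: "finite S" "S \<subseteq> sphere 0 1" "inj_on (harmonic_row I Y) S"
    and indep: "\<forall>c. (\<forall>f\<in>polys_deg_le m. (\<Sum>x\<in>S. c x * f x) = 0) \<longrightarrow> (\<forall>x\<in>S. c x = 0)"
    and y: "y \<in> sphere 0 1" and span: "harmonic_row I Y y \<in> span (harmonic_row I Y ` S)"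
  shows "y \<in> S"
proof (rule ccontr)
  assume "y \<notin> S"
  obtain u where "harmonic_row I Y y = (\<Sum>w\<in>harmonic_row I Y ` S. u w *\<^sub>R w)"
    using span S(1) by (auto simp: span_finite)
  then have comb: "harmonic_row I Y y = (\<Sum>x\<in>S. u (harmonic_row I Y x) *\<^sub>R harmonic_row I Y x)"
    by (simp add: sum.reindex[OF S(3)])
  define c where "c x = u (harmonic_row I Y x)" for x
  have eval: "f y = (\<Sum>x\<in>S. c x * f x)" if "f \<in> polys_deg_le (Suc m)" for f
    unfolding c_def using polys_deg_le_harmonic_row_combination(2)[OF Y I S(2) that y comb] .
  have "c z = 0" if z: "z \<in> S" for z
  proof -
    \<comment> \<open>This linear function tells \<open>z\<close> from \<open>y\<close>:
      \<open>h y - h z\<close> is the squared distance between them.\<close>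
    define h where "h x = (y - z) \<bullet> x" for x
    have h: "h \<in> polys_deg_le 1"
      unfolding h_def[abs_def] by (rule inner_in_polys_deg_le) simp
    have "(\<Sum>x\<in>S. c x * (h x - h y) * f x) = 0" if f: "f \<in> polys_deg_le m" for f
    proof -
      have "f \<in> polys_deg_le (Suc m)"
        using f polys_deg_le_mono[of m "Suc m"] by auto
      moreover have "(\<lambda>x. h x * f x) \<in> polys_deg_le (Suc m)"
        using polys_deg_le_mult[OF h f] by simp
      ultimately have "f y = (\<Sum>x\<in>S. c x * f x)" "h y * f y = (\<Sum>x\<in>S. c x * (h x * f x))"
        using eval by blast+
      then have "(\<Sum>x\<in>S. c x * (h x * f x)) - h y * (\<Sum>x\<in>S. c x * f x) = 0"
        by simp
      then show ?thesis
        by (simp add: sum_distrib_left sum_subtractf[symmetric] algebra_simps)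
    qed
    then have "\<forall>x\<in>S. c x * (h x - h y) = 0"
      using indep[rule_format, of "\<lambda>x. c x * (h x - h y)"] by blast
    then have "c z * (h z - h y) = 0"
      using z by (rule bspec)
    moreover have "h z - h y = - ((y - z) \<bullet> (y - z))"
      by (simp add: h_def inner_diff_right)
    moreover have "y \<noteq> z"
      using \<open>y \<notin> S\<close> z by blast
    ultimately show ?thesis
      by simp
  qed
  \<comment> \<open>With all coefficients zero, the evaluation formula for the constant 1 would read
    \<open>1 = 0\<close>.\<close>
  then have "(\<Sum>x\<in>S. c x * 1) = 0"
    by simp
  with eval[OF const_in_polys_deg_le[of 1]] show False
    by simp
qed

lemma q_separated_dist_ge:
  fixes \<Omega> :: "(real ^ 'd::finite) set"
  assumes \<Omega>: "finite \<Omega>" "\<Omega> \<subseteq> sphere 0 1" and q: "q > 0" "q_separated q \<Omega>"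
    and xy: "x \<in> \<Omega>" "y \<in> \<Omega>" "x \<noteq> y"
  shows "2 * q / pi \<le> dist x y"
proof -
  let ?A = "{arccos (x \<bullet> y) | x y. x \<in> \<Omega> \<and> y \<in> \<Omega> \<and> x \<noteq> y}"
  have "?A \<subseteq> (\<lambda>(x, y). arccos (x \<bullet> y)) ` (\<Omega> \<times> \<Omega>)"
    by auto
  then have "finite ?A"
    by (rule finite_subset) (intro finite_imageI finite_cartesian_product \<Omega>(1))
  moreover have "arccos (x \<bullet> y) \<in> ?A"
    using xy by blast
  ultimately have "sep \<Omega> \<le> arccos (x \<bullet> y)"
    unfolding sep_def by (rule Min_le)
  \<comment> \<open>Two distinct points are present, so the convention for one-point sets does not
    intervene.\<close>
  moreover have "card \<Omega> \<ge> 2"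
    using card_mono[OF \<Omega>(1), of "{x, y}"] xy by simp
  ultimately have "arccos (x \<bullet> y) > q"
    using q(2) by (simp add: q_separated_def)
  then show ?thesis
    using \<Omega>(2) xy q(1) by (intro dist_ge_arccos) auto
qed

text \<open>Serves the equality case: \<open>p y = 1\<close> says that the coefficients of the row
  beyond the first \<open>M\<close> vanish.\<close>

lemma orthonormal_basis_span_iff:
  fixes b :: "'j \<Rightarrow> 'i \<Rightarrow> real"
  assumes b: "orthonormal_basis_on (coord_inner I) (coord_space I) J b" and J: "finite J" "K \<subseteq> J"
    and v: "v \<in> coord_space I"
  shows "(\<forall>j\<in>J - K. coord_inner I (b j) v = 0) \<longleftrightarrow> v \<in> span (b ` K)"
proof
  assume 0: "\<forall>j\<in>J - K. coord_inner I (b j) v = 0"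
  have "v = (\<Sum>j\<in>J. coord_inner I (b j) v *\<^sub>R b j)"
    by (rule coord_orthonormal_expand(1)[OF b J(1) v])
  also have "\<dots> = (\<Sum>j\<in>K. coord_inner I (b j) v *\<^sub>R b j)"
    using J 0 by (intro sum.mono_neutral_right) auto
  also have "\<dots> \<in> span (b ` K)"
    by (intro span_sum span_scale span_base) simp
  finally show "v \<in> span (b ` K)" .
next
  assume v: "v \<in> span (b ` K)"
  show "\<forall>j\<in>J - K. coord_inner I (b j) v = 0"
  proof
    fix j assume j: "j \<in> J - K"
    have "coord_inner I (b j) s = 0" if s: "s \<in> b ` K" for s
    proof -
      obtain i where "s = b i" "i \<in> K"
        using s by (rule imageE)
      with j J(2) b show ?thesis
        unfolding orthonormal_basis_on_def by auto
    qed
    then show "coord_inner I (b j) v = 0"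
      using v by (rule coord_inner_span_eq_0)
  qed
qed

text \<open>\<open>pr\<close> and \<open>p\<close> are prescribed only on the sphere, so they have
  to be exchangeable with formulas that agree with them there.\<close>

lemma sphere_poly_cong:
  assumes "\<And>y. y \<in> sphere 0 1 \<Longrightarrow> f y = g y"
  shows "is_sphere_poly_deg_le n f \<longleftrightarrow> is_sphere_poly_deg_le n g"
  by (simp add: is_sphere_poly_deg_le_def assms)

lemma subspace_sphere_polys: "subspace {f. is_sphere_poly_deg_le n f}"
proof (rule subspace_CollectI)
  show "is_sphere_poly_deg_le n (\<lambda>x. 0)"
    unfolding is_sphere_poly_deg_le_def by (rule bexI[OF _ const_in_polys_deg_le[of 0]]) simp
next
  fix f g :: "real ^ 'a \<Rightarrow> real"
  assume "is_sphere_poly_deg_le n f"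
  then obtain f' where f': "f' \<in> polys_deg_le n" "\<forall>x\<in>sphere 0 1. f x = f' x"
    unfolding is_sphere_poly_deg_le_def ..
  assume "is_sphere_poly_deg_le n g"
  then obtain g' where g': "g' \<in> polys_deg_le n" "\<forall>x\<in>sphere 0 1. g x = g' x"
    unfolding is_sphere_poly_deg_le_def ..
  show "is_sphere_poly_deg_le n (\<lambda>x. f x + g x)"
    unfolding is_sphere_poly_deg_le_def
  proof (rule bexI)
    show "(\<lambda>x. f' x + g' x) \<in> polys_deg_le n"
      by (rule subspace_addI[OF subspace_polys_deg_le f'(1) g'(1)])
  qed (simp add: f'(2) g'(2))
next
  fix f :: "real ^ 'a \<Rightarrow> real" and c
  assume "is_sphere_poly_deg_le n f"
  then obtain f' where f': "f' \<in> polys_deg_le n" "\<forall>x\<in>sphere 0 1. f x = f' x"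
    unfolding is_sphere_poly_deg_le_def ..
  show "is_sphere_poly_deg_le n (\<lambda>x. c * f x)"
    unfolding is_sphere_poly_deg_le_def
  proof (rule bexI)
    show "(\<lambda>x. c * f' x) \<in> polys_deg_le n"
      by (rule subspace_multI[OF subspace_polys_deg_le f'(1)])
  qed (simp add: f'(2))
qed

lemma sphere_poly_power:
  assumes "is_sphere_poly_deg_le n f"
  shows "is_sphere_poly_deg_le (k * n) (\<lambda>x. f x ^ k)"
proof -
  obtain g where g: "g \<in> polys_deg_le n" "\<forall>x\<in>sphere 0 1. f x = g x"
    using assms unfolding is_sphere_poly_deg_le_def ..
  show ?thesis
    unfolding is_sphere_poly_deg_le_def
  proof (rule bexI)
    show "(\<lambda>x. g x ^ k) \<in> polys_deg_le (k * n)"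
      by (rule polys_deg_le_power[OF g(1)])
  qed (simp add: g(2))
qed

lemma spherical_harmonics_sphere_poly:
  assumes "f \<in> spherical_harmonics k" "k \<le> n"
  shows "is_sphere_poly_deg_le n f"
proof -
  obtain g where g: "g \<in> homogeneous_polys k" "f = on_sphere g"
    using assms(1) by (auto simp: spherical_harmonics_def)
  show ?thesis
    unfolding is_sphere_poly_deg_le_def
  proof (rule bexI)
    show "g \<in> polys_deg_le n"
      using homogeneous_polys_subset[OF assms(2)] g(1) by (rule subsetD)
  qed (simp add: g(2) on_sphere_def)
qed

theorem corollary3p15:
  fixes Y :: "nat \<Rightarrow> nat \<Rightarrow> real ^ 'd::finite \<Rightarrow> real"
    and x :: "nat \<Rightarrow> real ^ 'd"
    and n M N :: nat
    and Nk :: "nat \<Rightarrow> nat"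
    and I :: "(nat \<times> nat) set"
    and \<Omega> :: "(real ^ 'd) set"
    and q :: real
    and p_hat :: "nat \<Rightarrow> nat \<times> nat \<Rightarrow> real"
    and pr :: "nat \<Rightarrow> real ^ 'd \<Rightarrow> real"
    and p :: "real ^ 'd \<Rightarrow> real"
  assumes d: "CARD('d) \<ge> 2"
    and Y: "orthonormal_harmonics_family Y"
    and Nk_def: "\<And>k. Nk k = dim (spherical_harmonics k :: (real ^ 'd \<Rightarrow> real) set)"
    and N_def: "N = (\<Sum>k=0..n. Nk k)"
    and I_def: "I = (SIGMA k:{0..n}. {1..Nk k})"
    and n_pos: "n \<ge> 1"
    and M_pos: "M \<ge> 1"
    and Omega_def: "\<Omega> = x ` {1..M}"
    and x_sphere: "\<And>j. j \<in> {1..M} \<Longrightarrow> x j \<in> sphere 0 1"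
    and x_distinct: "inj_on x {1..M}"
    and q_pos: "q > 0"
    and separated: "q_separated q \<Omega>"
    and n_large: "real n > 2.5 * pi * real CARD('d) / q + 1"
    and p_hat_basis: "orthonormal_basis_on (coord_inner I) (coord_space I) {1..N} p_hat"
    and p_hat_orth: "\<And>r. r \<in> {1..M} \<Longrightarrow>
      p_hat r \<in> orth_complement I (matrix_kernel {1..M} I (sph_fourier_matrix Y x))"
    and pr_def: "\<And>r y. r \<in> {1..N} \<Longrightarrow> y \<in> sphere 0 1 \<Longrightarrow>
      pr r y = (\<Sum>k=0..n. \<Sum>l=1..Nk k. p_hat r (k, l) * Y k l y)"
    and p_def: "\<And>y. y \<in> sphere 0 1 \<Longrightarrow>
      p y = 2 * pi powr (real CARD('d) / 2) / (Gamma (real CARD('d) / 2) * real N) *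
            (\<Sum>r=1..M. \<bar>pr r y\<bar> ^ 2)"
  shows "is_sphere_poly_deg_le (2 * n) p \<and>
         (\<forall>y\<in>sphere 0 1. 0 \<le> p y \<and> p y \<le> 1) \<and>
         (\<forall>y\<in>sphere 0 1. p y = 1 \<longleftrightarrow> y \<in> \<Omega>)"
proof -
  let ?row = "harmonic_row I Y"
  define \<sigma> where "\<sigma> = 2 * pi powr (real CARD('d) / 2) / Gamma (real CARD('d) / 2)"
  have I: "I = (SIGMA k:{0..n}. {1..dim (spherical_harmonics k :: (real ^ 'd \<Rightarrow> real) set)})"
    by (simp add: I_def Nk_def)
  have fin_I: "finite I"
    unfolding I by (intro finite_SigmaI) simp_all
  have fin: "finite \<Omega>" and sph: "\<Omega> \<subseteq> sphere 0 1" and card: "card \<Omega> = M"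
    using x_sphere x_distinct by (auto simp: Omega_def card_image)
  \<comment> \<open>Independence is proved in degree \<open>m = n - 1\<close>, keeping one degree
    for multiplication by linear functions.\<close>
  obtain m where n: "n = Suc m"
    using n_pos by (cases n) auto
  have m: "real m * (2 * q / pi) \<ge> 5 * real CARD('d)"
  proof -
    have "real m > 2.5 * pi * real CARD('d) / q"
      using n_large n by simp
    then have "real m * q > 2.5 * pi * real CARD('d)"
      using q_pos by (simp add: pos_divide_less_eq)
    then show ?thesis
      by (simp add: field_simps)
  qed
  have indep: "c z = 0"
    if "\<And>f. f \<in> polys_deg_le m \<Longrightarrow> (\<Sum>x\<in>\<Omega>. c x * f x) = 0" "z \<in> \<Omega>" for c z
    using fin sph _ d q_separated_dist_ge[OF fin sph q_pos separated] m that
    by (rule separated_evaluations_independent) (use q_pos in simp)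
  have indep': "\<forall>c. (\<forall>f\<in>polys_deg_le m. (\<Sum>x\<in>\<Omega>. c x * f x) = 0) \<longrightarrow> (\<forall>z\<in>\<Omega>. c z = 0)"
    by (intro allI impI ballI) (rule indep, erule (1) bspec)
  have rows: "c z = 0" if "(\<Sum>x\<in>\<Omega>. c x *\<^sub>R ?row x) = 0" "z \<in> \<Omega>" for c z
  proof (rule indep[OF _ that(2)])
    fix f :: "real ^ 'd \<Rightarrow> real" assume "f \<in> polys_deg_le m"
    then have "f \<in> polys_deg_le n"
      using polys_deg_le_mono[of m n] n by auto
    then show "(\<Sum>x\<in>\<Omega>. c x * f x) = 0"
      using that(1) by (rule polys_deg_le_harmonic_row_combination(1)[OF Y I sph])
  qed
  have inj_row: "inj_on ?row \<Omega>" and indep_row: "independent (?row ` \<Omega>)"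
  proof -
    have "\<forall>c. (\<Sum>x\<in>\<Omega>. c x *\<^sub>R ?row x) = 0 \<longrightarrow> (\<forall>z\<in>\<Omega>. c z = 0)"
      using rows by (intro allI impI ballI)
    from independent_imageI[where r = ?row, OF fin this]
    show "inj_on ?row \<Omega>" "independent (?row ` \<Omega>)" .
  qed
  have basis: "inj_on p_hat {1..N}" "independent (p_hat ` {1..N})" "span (p_hat ` {1..N}) = coord_space I"
    using p_hat_basis by (auto simp: orthonormal_basis_on_def)
  have "?row ` \<Omega> \<subseteq> span (p_hat ` {1..N})"
    unfolding basis(3) by (auto simp: harmonic_row_in_coord_space)
  then have "card (?row ` \<Omega>) \<le> card (p_hat ` {1..N})"
    using independent_span_bound[OF finite_imageI[OF finite_atLeastAtMost] indep_row] by blast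
  \<comment> \<open>The \<open>M\<close> rows are independent vectors in a space with a basis of
    \<open>N\<close> elements.\<close>
  then have MN: "M \<le> N"
    unfolding card_image[OF inj_row] card_image[OF basis(1)] card by simp
  have sub: "{1..M} \<subseteq> {1..N}"
    using MN by simp
  \<comment> \<open>Orthogonality to the kernel places the first \<open>M\<close> basis vectors in
    the row space; being independent and equal in number to the rows, they span it.\<close>
  have span_eq: "span (p_hat ` {1..M}) = span (?row ` \<Omega>)"
  proof (rule span_eq_if_card_eq)
    show "independent (p_hat ` {1..M})"
      using basis(2) by (rule independent_mono) (use sub in blast)
    show "p_hat ` {1..M} \<subseteq> span (?row ` \<Omega>)"
    proof -
      have "(\<lambda>j i. if i \<in> I then sph_fourier_matrix Y x j i else 0) ` {1..M} = ?row ` \<Omega>"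
        unfolding Omega_def image_image
        by (intro image_cong refl) (auto simp: harmonic_row_def sph_fourier_matrix_def fun_eq_iff)
      then show ?thesis
        using p_hat_orth orth_complement_matrix_kernel[OF fin_I, of "{1..M}" "sph_fourier_matrix Y x"]
        by auto
    qed
    show "card (p_hat ` {1..M}) = card (?row ` \<Omega>)"
      unfolding card_image[OF inj_row] card_image[OF inj_on_subset[OF basis(1) sub]] card by simp
  qed (use fin in simp)
  have pr: "pr r y = coord_inner I (p_hat r) (?row y)" if "r \<in> {1..N}" "y \<in> sphere 0 1" for r y
  proof -
    have "coord_inner I (p_hat r) (?row y) = (\<Sum>(k, l)\<in>I. p_hat r (k, l) * Y k l y)"
      unfolding coord_inner_def by (intro sum.cong) (auto simp: harmonic_row_def)
    also have "\<dots> = pr r y"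
      unfolding I_def pr_def[OF that] by (rule sum.Sigma[symmetric]) simp_all
    finally show ?thesis ..
  qed
  have N: "real N > 0"
    using MN M_pos by simp
  have sig: "\<sigma> > 0"
    by (simp add: \<sigma>_def Gamma_real_pos)
  have p_eq: "p y = \<sigma> / real N * (\<Sum>r=1..M. (pr r y)\<^sup>2)" if "y \<in> sphere 0 1" for y
    unfolding p_def[OF that] by (simp add: \<sigma>_def)
  \<comment> \<open>By Parseval the sum over all \<open>N\<close> indices is the squared norm of the
    row, and the factor \<open>\<sigma> / N\<close> scales it to 1. The defect
    \<open>1 - p y\<close> is thus a sum of squares over the remaining indices, which yields both
    the upper bound and the equality case.\<close>
  have p1: "1 - p y = \<sigma> / real N * (\<Sum>r\<in>{1..N}-{1..M}. (pr r y)\<^sup>2)" if y: "y \<in> sphere 0 1" for y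
  proof -
    have "\<sigma> * coord_inner I (?row y) (?row y) = real N"
      unfolding \<sigma>_def coord_inner_harmonic_row_self[OF Y I y] N_def Nk_def ..
    moreover have "coord_inner I (?row y) (?row y) = (\<Sum>r\<in>{1..N}. (pr r y)\<^sup>2)"
      unfolding coord_orthonormal_expand(2)[OF p_hat_basis finite_atLeastAtMost harmonic_row_in_coord_space]
      using y by (intro sum.cong refl) (simp add: pr)
    ultimately have "\<sigma> / real N * (\<Sum>r\<in>{1..N}. (pr r y)\<^sup>2) = 1"
      using N by (simp add: field_simps)
    moreover have "(\<Sum>r\<in>{1..N}. (pr r y)\<^sup>2) =
        (\<Sum>r\<in>{1..N}-{1..M}. (pr r y)\<^sup>2) + (\<Sum>r\<in>{1..M}. (pr r y)\<^sup>2)"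
      by (rule sum.subset_diff[OF sub]) simp
    ultimately show ?thesis
      unfolding p_eq[OF y] by (simp only: distrib_left)
  qed
  have bounds: "0 \<le> p y \<and> p y \<le> 1" if "y \<in> sphere 0 1" for y
  proof
    show "0 \<le> p y"
      unfolding p_eq[OF that] using sig N by (intro mult_nonneg_nonneg sum_nonneg) auto
    have "0 \<le> 1 - p y"
      unfolding p1[OF that] using sig N by (intro mult_nonneg_nonneg sum_nonneg) auto
    then show "p y \<le> 1"
      by simp
  qed
  have eq1: "p y = 1 \<longleftrightarrow> y \<in> \<Omega>" if y: "y \<in> sphere 0 1" for y
  proof -
    have "p y = 1 \<longleftrightarrow> 1 - p y = 0"
      by auto
    also have "\<dots> \<longleftrightarrow> (\<Sum>r\<in>{1..N}-{1..M}. (pr r y)\<^sup>2) = 0"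
      unfolding p1[OF y] using sig N by (simp only: mult_eq_0_iff) auto
    also have "\<dots> \<longleftrightarrow> (\<forall>r\<in>{1..N}-{1..M}. coord_inner I (p_hat r) (?row y) = 0)"
      using y by (subst sum_nonneg_eq_0_iff) (auto simp: pr)
    also have "\<dots> \<longleftrightarrow> ?row y \<in> span (?row ` \<Omega>)"
      unfolding span_eq[symmetric]
      by (rule orthonormal_basis_span_iff[OF p_hat_basis _ sub harmonic_row_in_coord_space]) simp
    also have "\<dots> \<longleftrightarrow> y \<in> \<Omega>"
    proof
      show "y \<in> \<Omega>" if "?row y \<in> span (?row ` \<Omega>)"
        using harmonic_row_in_span_imp_mem[OF Y I[unfolded n] fin sph inj_row indep' y that] .
    qed (intro span_base imageI)
    finally show ?thesis .
  qed
  have "is_sphere_poly_deg_le n (pr r)" if r: "r \<in> {1..N}" for r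
  proof -
    have "(\<lambda>y. \<Sum>k=0..n. \<Sum>l=1..Nk k. p_hat r (k, l) * Y k l y) \<in> {f. is_sphere_poly_deg_le n f}"
    proof (intro subspace_sumI subspace_multI subspace_sphere_polys)
      fix k l assume k: "k \<in> {0..n}" and l: "l \<in> {1..Nk k}"
      have "orthonormal_basis_on sphere_L2_inner (spherical_harmonics k) {1..Nk k} (Y k)"
        using Y by (simp add: orthonormal_harmonics_family_def Nk_def)
      then have "Y k l \<in> spherical_harmonics k"
        using l by (rule orthonormal_basis_on_mem)
      with k show "Y k l \<in> {f. is_sphere_poly_deg_le n f}"
        by (simp add: spherical_harmonics_sphere_poly)
    qed
    then show ?thesis
      by (simp only: mem_Collect_eq sphere_poly_cong[OF pr_def[OF r]])
  qed
  then have "(\<lambda>y. \<sigma> / real N * (\<Sum>r=1..M. (pr r y)\<^sup>2)) \<in> {f. is_sphere_poly_deg_le (2 * n) f}"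
    using sub by (intro subspace_sumI subspace_multI subspace_sphere_polys CollectI sphere_poly_power) auto
  then have "is_sphere_poly_deg_le (2 * n) p"
    by (simp only: mem_Collect_eq sphere_poly_cong[OF p_eq])
  with bounds eq1 show ?thesis
    by blast
qed

end
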